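(* Let $n$ be a positive integer and $A\in W^{n-1,q}(\mathbb{D},\mathbb{B})$, $q>2$. The Dirichlet problem $$\begin{cases}(\bar\partial-A)^n w=0, & \text{in }\mathbb{D},\\ w=0, & \text{on }\partial\mathbb{D},\end{cases}$$ for bicomplex-valued functions $w$, has infinitely many solutions.
   Context: $\mathbb{D}$ is the complex unit disk. The bicomplex numbers $\mathbb{B}$ are the commutative algebra of elements $z_1+jz_2$ with $z_1,z_2\in\mathbb{C}$, $j^2=-1$, $ij=ji$. With $w^\pm=z_1\mp iz_2$ for $w=z_1+jz_2$, the bicomplex norm is $\|w\|_{\mathbb{B}}=\sqrt{(|w^+|^2+|w^-|^2)/2}$. $L^q(\mathbb{D},\mathbb{B})$ is the space of functions $f:\mathbb{D}\to\mathbb{B}$ with $\left(\iint_{\mathbb{D}}\|f(z)\|_{\mathbb{B}}^q\,dx\,dy\right)^{1/q}<\infty$, and $W^{n-1,q}(\mathbb{D},\mathbb{B})$ is the space of functions $f:\mathbb{D}\to\mathbb{B}$ such that $f$ and its derivatives up to order $n-1$ are in $L^q(\mathbb{D},\mathbb{B})$. The operator $\bar\partial=\frac12\left(\frac{\partial}{\partial x}+j\frac{\partial}{\partial y}\right)$ acts on $\mathbb{B}$-valued functions of the single complex variable $z=x+iy$, and $(\bar\partial-A)^n$ is the $n$-fold composition of the operator $w\mapsto\bar\partial w-Aw$.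
   Formalization: The formal theorem assumes n ≥ 2 instead of n a positive integer, because for n = 1 the claim is false: for A = 0 the components of w are holomorphic and antiholomorphic with zero boundary values, so w = 0 is the only solution. *)

theory Defs
  imports "HOL-Analysis.Analysis"
begin

section \<open>Bicomplex numbers\<close>

text \<open>\<^term>\<open>Bicomplex z1 z2\<close> stands for \<open>z1 + j z2\<close>.\<close>

datatype bicomplex = Bicomplex (bc1: complex) (bc2: complex)

definition bc_j :: bicomplex where
  "bc_j = Bicomplex 0 1"

definition bc_plus :: "bicomplex \<Rightarrow> complex" where
  "bc_plus w = bc1 w - \<i> * bc2 w"

definition bc_minus :: "bicomplex \<Rightarrow> complex" where
  "bc_minus w = bc1 w + \<i> * bc2 w"

lemma bicomplex_eqI: "bc1 u = bc1 v \<Longrightarrow> bc2 u = bc2 v \<Longrightarrow> u = v"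
  by (rule bicomplex.expand) simp

instantiation bicomplex :: comm_ring_1
begin

definition "0 = Bicomplex 0 0"
definition "1 = Bicomplex 1 0"
definition "u + v = Bicomplex (bc1 u + bc1 v) (bc2 u + bc2 v)"
definition "u - v = Bicomplex (bc1 u - bc1 v) (bc2 u - bc2 v)"
definition "- u = Bicomplex (- bc1 u) (- bc2 u)"
definition "u * v = Bicomplex (bc1 u * bc1 v - bc2 u * bc2 v) (bc1 u * bc2 v + bc2 u * bc1 v)"

instance
  by standard
    (auto simp: zero_bicomplex_def one_bicomplex_def plus_bicomplex_def minus_bicomplex_def
      uminus_bicomplex_def times_bicomplex_def algebra_simps)

end

instantiation bicomplex :: real_algebra_1
begin

definition "r *\<^sub>R u = Bicomplex (r *\<^sub>R bc1 u) (r *\<^sub>R bc2 u)"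

instance
  by standard
    (auto simp: scaleR_bicomplex_def plus_bicomplex_def times_bicomplex_def algebra_simps)

end

lemma bc1_simps [simp]:
  "bc1 0 = 0" "bc1 1 = 1" "bc1 (u + v) = bc1 u + bc1 v" "bc1 (u - v) = bc1 u - bc1 v"
  "bc1 (- u) = - bc1 u" "bc1 (u * v) = bc1 u * bc1 v - bc2 u * bc2 v"
  "bc1 (r *\<^sub>R u) = r *\<^sub>R bc1 u" "bc1 bc_j = 0"
  by (simp_all add: zero_bicomplex_def one_bicomplex_def plus_bicomplex_def minus_bicomplex_def
      uminus_bicomplex_def times_bicomplex_def scaleR_bicomplex_def bc_j_def)

lemma bc2_simps [simp]:
  "bc2 0 = 0" "bc2 1 = 0" "bc2 (u + v) = bc2 u + bc2 v" "bc2 (u - v) = bc2 u - bc2 v"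
  "bc2 (- u) = - bc2 u" "bc2 (u * v) = bc1 u * bc2 v + bc2 u * bc1 v"
  "bc2 (r *\<^sub>R u) = r *\<^sub>R bc2 u" "bc2 bc_j = 1"
  by (simp_all add: zero_bicomplex_def one_bicomplex_def plus_bicomplex_def minus_bicomplex_def
      uminus_bicomplex_def times_bicomplex_def scaleR_bicomplex_def bc_j_def)

lemma bc_j_squared: "bc_j * bc_j = -1"
  by (rule bicomplex_eqI) simp_all

lemma bicomplex_decompose: "w = Bicomplex (bc1 w) 0 + bc_j * Bicomplex (bc2 w) 0"
  by (rule bicomplex_eqI) simp_all

lemma bc_norm_parallelogram:
  "((cmod (bc_plus w))\<^sup>2 + (cmod (bc_minus w))\<^sup>2) / 2 = bc1 w \<bullet> bc1 w + bc2 w \<bullet> bc2 w"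
  unfolding bc_plus_def bc_minus_def cmod_power2 inner_complex_def
  by (simp add: power2_eq_square algebra_simps)

text \<open>The norm satisfies only \<open>norm (u * v) \<le> sqrt 2 * norm u * norm v\<close>, so there is no
  \<^class>\<open>real_normed_algebra\<close> instance.\<close>

instantiation bicomplex :: real_inner
begin

definition inner_bicomplex :: "bicomplex \<Rightarrow> bicomplex \<Rightarrow> real" where
  "inner_bicomplex u v = bc1 u \<bullet> bc1 v + bc2 u \<bullet> bc2 v"

definition norm_bicomplex :: "bicomplex \<Rightarrow> real" where
  "norm_bicomplex w = sqrt (((cmod (bc_plus w))\<^sup>2 + (cmod (bc_minus w))\<^sup>2) / 2)"

definition sgn_bicomplex :: "bicomplex \<Rightarrow> bicomplex" where
  "sgn_bicomplex w = w /\<^sub>R norm w"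

definition dist_bicomplex :: "bicomplex \<Rightarrow> bicomplex \<Rightarrow> real" where
  "dist_bicomplex u v = norm (u - v)"

definition uniformity_bicomplex :: "(bicomplex \<times> bicomplex) filter" where
  "uniformity_bicomplex = (INF e\<in>{0 <..}. principal {(x, y). dist x y < e})"

definition open_bicomplex :: "bicomplex set \<Rightarrow> bool" where
  "open_bicomplex U \<longleftrightarrow> (\<forall>x\<in>U. eventually (\<lambda>(x', y). x' = x \<longrightarrow> y \<in> U) uniformity)"

instance
proof
  fix x y z :: bicomplex and r :: real
  show "inner x y = inner y x"
    by (simp add: inner_bicomplex_def inner_commute)
  show "inner (x + y) z = inner x z + inner y z"
    by (simp add: inner_bicomplex_def inner_add_left)
  show "inner (r *\<^sub>R x) y = r * inner x y"
    by (simp add: inner_bicomplex_def algebra_simps)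
  show "0 \<le> inner x x"
    by (simp add: inner_bicomplex_def)
  show "inner x x = 0 \<longleftrightarrow> x = 0"
  proof
    assume "inner x x = 0"
    then have "bc1 x = 0 \<and> bc2 x = 0"
      by (simp add: inner_bicomplex_def add_nonneg_eq_0_iff)
    then show "x = 0"
      by (intro bicomplex_eqI) simp_all
  qed (simp add: inner_bicomplex_def)
  show "norm x = sqrt (inner x x)"
    by (simp only: norm_bicomplex_def inner_bicomplex_def bc_norm_parallelogram)
qed (rule sgn_bicomplex_def dist_bicomplex_def uniformity_bicomplex_def open_bicomplex_def)+

end

instantiation bicomplex :: euclidean_space
begin

definition Basis_bicomplex :: "bicomplex set" where
  "Basis_bicomplex = {Bicomplex 1 0, Bicomplex \<i> 0, Bicomplex 0 1, Bicomplex 0 \<i>}"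

instance
proof
  show "(Basis :: bicomplex set) \<noteq> {}" "finite (Basis :: bicomplex set)"
    by (simp_all add: Basis_bicomplex_def)
  show "inner u v = (if u = v then 1 else 0)" if "u \<in> Basis" "v \<in> Basis" for u v :: bicomplex
    using that unfolding Basis_bicomplex_def
    by (elim insertE emptyE) (simp_all add: inner_bicomplex_def inner_complex_def complex_eq_iff)
  show "(\<forall>u\<in>Basis. inner x u = 0) \<longleftrightarrow> x = 0" for x :: bicomplex
  proof
    assume "\<forall>u\<in>Basis. inner x u = 0"
    then have "Re (bc1 x) = 0 \<and> Im (bc1 x) = 0 \<and> Re (bc2 x) = 0 \<and> Im (bc2 x) = 0"
      by (simp add: Basis_bicomplex_def inner_bicomplex_def inner_complex_def)
    then show "x = 0"
      by (intro bicomplex_eqI complex_eqI) simp_all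
  qed (simp add: inner_bicomplex_def)
qed

end


section \<open>Weak derivatives on the unit disk\<close>

abbreviation unit_disk :: "complex set" where
  "unit_disk \<equiv> ball 0 1"

definition pd_x :: "(complex \<Rightarrow> real) \<Rightarrow> complex \<Rightarrow> real" where
  "pd_x \<phi> z = frechet_derivative \<phi> (at z) 1"

definition pd_y :: "(complex \<Rightarrow> real) \<Rightarrow> complex \<Rightarrow> real" where
  "pd_y \<phi> z = frechet_derivative \<phi> (at z) \<i>"

primrec C_k :: "nat \<Rightarrow> (complex \<Rightarrow> real) \<Rightarrow> bool" where
  "C_k 0 \<phi> \<longleftrightarrow> continuous_on UNIV \<phi>"
| "C_k (Suc k) \<phi> \<longleftrightarrow> (\<forall>z. \<phi> differentiable (at z)) \<and> C_k k (pd_x \<phi>) \<and> C_k k (pd_y \<phi>)"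

definition test_function :: "(complex \<Rightarrow> real) \<Rightarrow> bool" where
  "test_function \<phi> \<longleftrightarrow>
     (\<forall>k. C_k k \<phi>) \<and> (\<exists>K. compact K \<and> K \<subseteq> unit_disk \<and> (\<forall>z. z \<notin> K \<longrightarrow> \<phi> z = 0))"

definition loc_integrable :: "(complex \<Rightarrow> bicomplex) \<Rightarrow> bool" where
  "loc_integrable f \<longleftrightarrow> (\<forall>K. compact K \<and> K \<subseteq> unit_disk \<longrightarrow> set_integrable lebesgue K f)"

definition weak_deriv ::
    "nat \<Rightarrow> nat \<Rightarrow> (complex \<Rightarrow> bicomplex) \<Rightarrow> (complex \<Rightarrow> bicomplex) \<Rightarrow> bool" where
  "weak_deriv a b f g \<longleftrightarrow> loc_integrable f \<and> loc_integrable g \<and>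
     (\<forall>\<phi>. test_function \<phi> \<longrightarrow>
        (LINT z:unit_disk|lebesgue. ((pd_x ^^ a) ((pd_y ^^ b) \<phi>)) z *\<^sub>R f z) =
        (-1) ^ (a + b) *\<^sub>R (LINT z:unit_disk|lebesgue. \<phi> z *\<^sub>R g z))"

text \<open>\<open>g\<close> is the distribution \<open>(\<partial>f/\<partial>x + j \<partial>f/\<partial>y) / 2\<close>.\<close>

definition weak_dbar :: "(complex \<Rightarrow> bicomplex) \<Rightarrow> (complex \<Rightarrow> bicomplex) \<Rightarrow> bool" where
  "weak_dbar f g \<longleftrightarrow> loc_integrable f \<and> loc_integrable g \<and>
     (\<forall>\<phi>. test_function \<phi> \<longrightarrow>
        (LINT z:unit_disk|lebesgue. ((1/2) *\<^sub>R (of_real (pd_x \<phi> z) + bc_j * of_real (pd_y \<phi> z))) * f z) =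
        - (LINT z:unit_disk|lebesgue. \<phi> z *\<^sub>R g z))"


section \<open>Lebesgue and Sobolev spaces\<close>

definition L_space :: "real \<Rightarrow> (complex \<Rightarrow> bicomplex) set" where
  "L_space q = {f. f \<in> borel_measurable (lebesgue_on unit_disk) \<and>
                   integrable (lebesgue_on unit_disk) (\<lambda>z. norm (f z) powr q)}"

definition W_space :: "nat \<Rightarrow> real \<Rightarrow> (complex \<Rightarrow> bicomplex) set" where
  "W_space m q = {f \<in> L_space q. \<forall>a b. a + b \<le> m \<longrightarrow> (\<exists>g \<in> L_space q. weak_deriv a b f g)}"


section \<open>The Dirichlet problem\<close>

text \<open>Weak derivatives are determined only almost everywhere, so the operator \<open>w \<mapsto> \<partial>bar w - A w\<close>
  is the relation \<open>vekua_op A\<close> on representatives; its iterates are the relational powers.\<close>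

definition vekua_op ::
    "(complex \<Rightarrow> bicomplex) \<Rightarrow> (complex \<Rightarrow> bicomplex) \<Rightarrow> (complex \<Rightarrow> bicomplex) \<Rightarrow> bool" where
  "vekua_op A w v \<longleftrightarrow>
     (\<exists>g. weak_dbar w g \<and> (AE z in lebesgue_on unit_disk. v z = g z - A z * w z))"

definition dirichlet_solution :: "nat \<Rightarrow> (complex \<Rightarrow> bicomplex) \<Rightarrow> (complex \<Rightarrow> bicomplex) \<Rightarrow> bool" where
  "dirichlet_solution n A w \<longleftrightarrow>
     (vekua_op A ^^ n) w (\<lambda>z. 0) \<and>
     continuous_on (cball 0 1) w \<and> (\<forall>z \<in> sphere 0 1. w z = 0)"

end

theory Submission
  imports Defs
begin

text \<open>Under the idempotent splitting \<open>w \<mapsto> (w\<^sup>+, w\<^sup>-)\<close> multiplication by \<open>j\<close> acts on \<open>w\<^sup>-\<close> as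
  multiplication by \<open>\<i>\<close>, so on functions with \<open>w\<^sup>+ = 0\<close> the equation is a classical Vekua equation for
  the Cauchy--Riemann operator with coefficient \<open>A\<^sup>-\<close>. If \<open>\<partial>bar s = A\<^sup>-\<close> with \<open>s\<close> continuous, then
  \<open>c (1 - z cnj z) e\<^sup>s\<close> vanishes on the circle, one application of \<open>\<partial>bar - A\<close> turns it into
  \<open>- c z e\<^sup>s\<close>, and a second one into \<open>0\<close>; every real \<open>c\<close> gives another solution.

  Up to a constant, \<open>s\<close> is the Cauchy transform of \<open>A\<^sup>-\<close>, obtained as the uniform limit of the convolutions
  with \<open>cnj z / (\<bar>z\<bar>\<^sup>2 + \<delta>\<^sup>2)\<close>; uniformity is where \<open>q > 2\<close> enters. The \<open>\<partial>bar\<close>-derivative of this kernel is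
  the approximate identity \<open>\<delta>\<^sup>2 / (\<bar>z\<bar>\<^sup>2 + \<delta>\<^sup>2)\<^sup>2\<close>, so the chain rule for \<open>e\<^sup>s\<close> holds classically before
  the limit and passes to the weak equation in the limit.\<close>

section \<open>Integrability on the complex plane\<close>

text \<open>On [0,1] the factor x^(-r) dominates and is integrable because r < 1. On [1,\<infinity>)
  the product is at most x^(-3r), integrable because 3r > 1.\<close>

lemma integrable_on_halfline_powr_decay:
  fixes r :: real
  assumes "1/2 < r" "r < 1"
  shows "integrable lborel (\<lambda>x. indicator {0..} x * (x powr (-r) * (1 + x\<^sup>2) powr (-r)))"
proof -
  have 1: "integrable lebesgue (\<lambda>x. indicator {0..1} x * x powr (-r))"
  proof -
    have "(\<lambda>x. x powr (-r)) absolutely_integrable_on {0..1}"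
      using integrable_on_powr_from_0[of "-r" 1] assms
      by (intro nonnegative_absolutely_integrable_1) auto
    then show ?thesis by (simp add: set_integrable_def)
  qed
  have 2: "integrable lebesgue (\<lambda>x. indicator {1..} x * x powr (-3*r))"
  proof -
    have "(\<lambda>x. x powr (-3*r)) absolutely_integrable_on {1..}"
      using has_integral_powr_to_inf[of "-3*r" 1] assms
      by (intro nonnegative_absolutely_integrable_1) (auto simp: integrable_on_def)
    then show ?thesis by (simp add: set_integrable_def)
  qed
  have "integrable lborel (\<lambda>x. indicator {0..1} x * x powr (-r) + indicator {1..} x * x powr (-3*r))"
    using 1 2 by (intro Bochner_Integration.integrable_add) (simp_all add: integrable_completion)
  then show ?thesis
  proof (rule Bochner_Integration.integrable_bound)
    have "x powr (-r) * (1 + x\<^sup>2) powr (-r) \<le> x powr (-r)" if "x \<ge> 0" for x :: real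
      using that assms powr_mono2'[of "-r" 1 "1 + x\<^sup>2"] by (auto intro: mult_left_le)
    moreover have "x powr (-r) * (1 + x\<^sup>2) powr (-r) \<le> x powr (-3*r)" if "x \<ge> 1" for x :: real
    proof -
      have "(1 + x\<^sup>2) powr (-r) \<le> (x\<^sup>2) powr (-r)"
        using that assms by (intro powr_mono2') auto
      also have "\<dots> = x powr (-2*r)"
        using that by (simp add: powr_powr flip: powr_numeral)
      finally have "x powr (-r) * (1 + x\<^sup>2) powr (-r) \<le> x powr (-r) * x powr (-2*r)"
        by (intro mult_left_mono) auto
      then show ?thesis by (simp flip: powr_add)
    qed
    ultimately show "AE x in lborel. norm (indicator {0..} x * (x powr (-r) * (1 + x\<^sup>2) powr (-r)))
      \<le> norm (indicator {0..1} x * x powr (-r) + indicator {1..} x * x powr (-3*r))"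
      by (intro AE_I2) (fastforce simp: abs_mult indicator_def)
  qed simp
qed

lemma integrable_powr_decay:
  fixes r :: real
  assumes "1/2 < r" "r < 1"
  shows "integrable lborel (\<lambda>x. \<bar>x\<bar> powr (-r) * (1 + x\<^sup>2) powr (-r))"
proof -
  let ?h = "\<lambda>x. indicator {0..} x * (x powr (-r) * (1 + x\<^sup>2) powr (-r))"
  have h: "integrable lborel ?h"
    using assms by (rule integrable_on_halfline_powr_decay)
  moreover have "integrable lborel (\<lambda>x. ?h (0 + (-1) * x))"
    using h by (rule lborel_integrable_real_affine) auto
  ultimately have "integrable lborel (\<lambda>x. ?h x + ?h (0 + (-1) * x))"
    by (rule Bochner_Integration.integrable_add)
  \<comment> \<open>Both halves contain x = 0, but \<open>0 powr (-r)\<close> is 0, so counting it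
    twice does no harm.\<close>
  moreover have "\<bar>x\<bar> powr (-r) * (1 + x\<^sup>2) powr (-r) = ?h x + ?h (0 + (-1) * x)" for x
    by (auto simp: indicator_def)
  ultimately show ?thesis by simp
qed

text \<open>The coordinate axes have to be discarded later: \<open>0 powr (-r)\<close> is 0, so a
  majorant with negative powers of the coordinates vanishes there.\<close>

lemma AE_lborel_Re_nonzero: "AE z in lborel. Re z \<noteq> 0"
proof -
  have "negligible {z::complex. z \<bullet> 1 = 0}"
    by (rule negligible_standard_hyperplane) (simp add: Basis_complex_def)
  then have "AE z in lebesgue. z \<notin> {z::complex. z \<bullet> 1 = 0}"
    by (intro AE_not_in) (simp add: negligible_iff_null_sets)
  then show ?thesis by (simp add: AE_completion_iff)
qed

lemma AE_lborel_Im_nonzero: "AE z in lborel. Im z \<noteq> 0"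
proof -
  have "negligible {z::complex. z \<bullet> \<i> = 0}"
    by (rule negligible_standard_hyperplane) (simp add: Basis_complex_def)
  then have "AE z in lebesgue. z \<notin> {z::complex. z \<bullet> \<i> = 0}"
    by (intro AE_not_in) (simp add: negligible_iff_null_sets)
  then show ?thesis by (simp add: AE_completion_iff)
qed

lemma integrable_complex_product:
  fixes g :: "real \<Rightarrow> real"
  assumes g: "integrable lborel g" and pos: "\<And>x. g x \<ge> 0"
  shows "integrable lborel (\<lambda>z. g (Re z) * g (Im z))"
proof -
  have [measurable]: "g \<in> borel_measurable borel" using g by simp
  have "(\<integral>\<^sup>+z. ennreal (norm (g (Re z) * g (Im z))) \<partial>lborel)
      = (\<integral>\<^sup>+z. (\<Prod>b\<in>Basis. ennreal (g ((z::complex) \<bullet> b))) \<partial>lborel)"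
    using pos by (simp add: Basis_complex_def ennreal_mult)
  also have "\<dots> = (\<Prod>b\<in>(Basis::complex set). \<integral>\<^sup>+x. ennreal (g x) \<partial>lborel)"
    by (rule nn_integral_lborel_prod) auto
  also have "\<dots> < \<infinity>"
    using g pos by (auto simp: Basis_complex_def nn_integral_eq_integral ennreal_mult_less_top)
  finally show ?thesis by (intro integrableI_bounded) auto
qed

text \<open>A majorant that is a product of functions of one coordinate replaces polar coordinates
  in testing the decay of radial functions.\<close>

lemma integrable_complex_powr_decay:
  fixes r :: real and f :: "complex \<Rightarrow> real"
  assumes r: "1/2 < r" "r < 1" and [measurable]: "f \<in> borel_measurable borel"
    and bound: "\<And>z. Re z \<noteq> 0 \<Longrightarrow> Im z \<noteq> 0 \<Longrightarrow>
      \<bar>f z\<bar> \<le> (\<bar>Re z\<bar> * (1 + (Re z)\<^sup>2) * (\<bar>Im z\<bar> * (1 + (Im z)\<^sup>2))) powr (-r)"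
  shows "integrable lborel f"
proof (rule Bochner_Integration.integrable_bound)
  show "integrable lborel (\<lambda>z. (\<bar>Re z\<bar> powr (-r) * (1 + (Re z)\<^sup>2) powr (-r))
      * (\<bar>Im z\<bar> powr (-r) * (1 + (Im z)\<^sup>2) powr (-r)))"
    using integrable_powr_decay[OF r] by (rule integrable_complex_product) auto
  show "AE z in lborel. norm (f z) \<le> norm ((\<bar>Re z\<bar> powr (-r) * (1 + (Re z)\<^sup>2) powr (-r))
      * (\<bar>Im z\<bar> powr (-r) * (1 + (Im z)\<^sup>2) powr (-r)))"
    using AE_lborel_Re_nonzero AE_lborel_Im_nonzero
  proof eventually_elim
    case (elim z)
    then show ?case using bound[of z]
      by (simp add: powr_mult abs_mult)
  qed
qed simp

text \<open>Multiply |x||y| \<le> x^2 + y^2 by (1 + x^2)(1 + y^2) \<le> (1 + x^2 + y^2)^2. With z =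
  x + iy the right side is the square of |z|(1 + |z|^2).\<close>

lemma cauchy_decay_bound:
  fixes x y :: real
  shows "\<bar>x\<bar> * (1 + x\<^sup>2) * (\<bar>y\<bar> * (1 + y\<^sup>2)) \<le> (x\<^sup>2 + y\<^sup>2) * (1 + (x\<^sup>2 + y\<^sup>2))\<^sup>2"
proof -
  have "0 \<le> (\<bar>x\<bar> - \<bar>y\<bar>)\<^sup>2" "0 \<le> \<bar>x\<bar> * \<bar>y\<bar>" by simp_all
  then have "\<bar>x\<bar> * \<bar>y\<bar> \<le> x\<^sup>2 + y\<^sup>2"
    unfolding power2_diff power2_abs by linarith
  moreover have "(1 + x\<^sup>2) * (1 + y\<^sup>2) \<le> (1 + (x\<^sup>2 + y\<^sup>2))\<^sup>2"
    unfolding power2_eq_square[of "1 + (x\<^sup>2 + y\<^sup>2)"] by (intro mult_mono) auto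
  ultimately have "(\<bar>x\<bar> * \<bar>y\<bar>) * ((1 + x\<^sup>2) * (1 + y\<^sup>2)) \<le> (x\<^sup>2 + y\<^sup>2) * (1 + (x\<^sup>2 + y\<^sup>2))\<^sup>2"
    by (intro mult_mono) auto
  then show ?thesis by (simp add: mult_ac)
qed

text \<open>With N = 1 + |z|^2 the coordinate product is at most (N - 1)N^2 \<le> N^3, and the
  exponent -2/3 turns N^3 into 1/N^2. The integrand is \<open>approx_identity 1\<close>.\<close>

lemma integrable_inverse_square_decay:
  "integrable lborel (\<lambda>z::complex. 1 / (1 + (cmod z)\<^sup>2)\<^sup>2)"
proof (rule integrable_complex_powr_decay[of "2/3"])
  fix z :: complex assume nz: "Re z \<noteq> 0" "Im z \<noteq> 0"
  define N where "N = 1 + (cmod z)\<^sup>2"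
  have "N > 0" by (simp add: N_def add_pos_nonneg)
  have "\<bar>Re z\<bar> * (1 + (Re z)\<^sup>2) * (\<bar>Im z\<bar> * (1 + (Im z)\<^sup>2)) \<le> (N - 1) * N\<^sup>2"
    using cauchy_decay_bound[of "Re z" "Im z"] by (simp add: N_def cmod_power2)
  also have "\<dots> \<le> N powr 3"
    using \<open>N > 0\<close> by (simp add: power3_eq_cube power2_eq_square algebra_simps)
  finally have "(N powr 3) powr (-(2/3)) \<le>
     (\<bar>Re z\<bar> * (1 + (Re z)\<^sup>2) * (\<bar>Im z\<bar> * (1 + (Im z)\<^sup>2))) powr (-(2/3))"
    using nz by (intro powr_mono2') (auto intro!: mult_pos_pos add_pos_nonneg)
  moreover have "(N powr 3) powr (-(2/3)) = 1 / N\<^sup>2"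
    using \<open>N > 0\<close> by (simp only: powr_powr) (simp add: powr_minus_divide)
  ultimately show "\<bar>1 / (1 + (cmod z)\<^sup>2)\<^sup>2\<bar> \<le>
     (\<bar>Re z\<bar> * (1 + (Re z)\<^sup>2) * (\<bar>Im z\<bar> * (1 + (Im z)\<^sup>2))) powr (-(2/3))"
    by (simp add: N_def)
qed auto

text \<open>The integrand is the p-th power of \<open>kernel_defect 1\<close>. The coordinate
  product is bounded by the square of the denominator, hence the exponent p/2, and p < 2 tames the
  singularity at 0.\<close>

lemma integrable_cauchy_defect:
  assumes "1 < p" "p < 2"
  shows "integrable lborel (\<lambda>z::complex. (1 / (cmod z * (1 + (cmod z)\<^sup>2))) powr p)"
proof (rule integrable_complex_powr_decay[of "p/2"])
  fix z :: complex assume nz: "Re z \<noteq> 0" "Im z \<noteq> 0"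
  define N where "N = cmod z * (1 + (cmod z)\<^sup>2)"
  have "z \<noteq> 0" using nz by auto
  then have "N > 0" by (simp add: N_def add_pos_nonneg)
  have "\<bar>Re z\<bar> * (1 + (Re z)\<^sup>2) * (\<bar>Im z\<bar> * (1 + (Im z)\<^sup>2)) \<le> N powr 2"
    using cauchy_decay_bound[of "Re z" "Im z"] \<open>N > 0\<close>
    by (simp add: N_def cmod_power2 power_mult_distrib)
  then have "(N powr 2) powr (-(p/2)) \<le>
     (\<bar>Re z\<bar> * (1 + (Re z)\<^sup>2) * (\<bar>Im z\<bar> * (1 + (Im z)\<^sup>2))) powr (-(p/2))"
    using nz assms by (intro powr_mono2') (auto intro!: mult_pos_pos add_pos_nonneg)
  moreover have "(N powr 2) powr (-(p/2)) = (1 / N) powr p"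
    using \<open>N > 0\<close> by (simp only: powr_powr) (simp add: powr_minus_divide powr_divide)
  ultimately show "\<bar>(1 / (cmod z * (1 + (cmod z)\<^sup>2))) powr p\<bar> \<le>
     (\<bar>Re z\<bar> * (1 + (Re z)\<^sup>2) * (\<bar>Im z\<bar> * (1 + (Im z)\<^sup>2))) powr (-(p/2))"
    by (simp add: N_def)
qed (use assms in auto)

section \<open>Directional derivatives and convolutions\<close>

lemma has_vector_derivative_at_0_iff:
  fixes f :: "real \<Rightarrow> 'a::real_normed_vector"
  shows "(f has_vector_derivative D) (at 0) \<longleftrightarrow> ((\<lambda>t. (f t - f 0) /\<^sub>R t) \<longlongrightarrow> D) (at 0)"
proof -
  have "norm (f (0 + t) - f 0 - t *\<^sub>R D) / norm t = norm ((f t - f 0) /\<^sub>R t - D)" if "t \<noteq> 0" for t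
  proof -
    have "(f t - f 0) /\<^sub>R t - D = (f t - f 0 - t *\<^sub>R D) /\<^sub>R t"
      using that by (simp add: scaleR_diff_right)
    then show ?thesis by (simp add: divide_inverse mult.commute)
  qed
  then have "((\<lambda>t. norm (f (0 + t) - f 0 - t *\<^sub>R D) / norm t) \<longlongrightarrow> 0) (at 0) \<longleftrightarrow>
      ((\<lambda>t. norm ((f t - f 0) /\<^sub>R t - D)) \<longlongrightarrow> 0) (at 0)"
    by (intro tendsto_cong) (simp add: eventually_at_filter)
  then show ?thesis
    by (simp add: has_vector_derivative_def has_derivative_at bounded_linear_scaleR_left
        tendsto_norm_zero_iff LIM_zero_iff)
qed

text \<open>Derivatives are taken along single lines, with \<open>d\<close> equal to 1 and \<i>
  giving the two partial derivatives. Product and chain rules then come from one real variable, and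
  differentiation under the integral concerns scalar difference quotients.\<close>

definition dir_deriv :: "complex \<Rightarrow> (complex \<Rightarrow> complex) \<Rightarrow> complex \<Rightarrow> complex \<Rightarrow> bool" where
  "dir_deriv d F F' z \<longleftrightarrow> ((\<lambda>t. F (z + of_real t * d)) has_vector_derivative F') (at 0)"

lemma dir_deriv_iff_tendsto:
  "dir_deriv d F F' z \<longleftrightarrow> ((\<lambda>t. (F (z + of_real t * d) - F z) /\<^sub>R t) \<longlongrightarrow> F') (at 0)"
  by (simp add: dir_deriv_def has_vector_derivative_at_0_iff)

lemma dir_deriv_mult:
  assumes "dir_deriv d F F' z" "dir_deriv d G G' z"
  shows "dir_deriv d (\<lambda>w. F w * G w) (F z * G' + F' * G z) z"
  using has_vector_derivative_mult[OF assms[unfolded dir_deriv_def]]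
  by (simp add: dir_deriv_def)

lemma dir_deriv_exp:
  assumes "dir_deriv d F F' z"
  shows "dir_deriv d (\<lambda>w. exp (F w)) (F' * exp (F z)) z"
proof -
  have "(exp has_field_derivative exp (F z)) (at (F (z + of_real 0 * d)))"
    by (auto intro!: derivative_eq_intros)
  from field_vector_diff_chain_at[OF assms[unfolded dir_deriv_def] this]
  show ?thesis by (simp add: dir_deriv_def o_def)
qed

lemma dir_deriv_along_line:
  assumes "dir_deriv d F F' (z + of_real t0 * d)"
  shows "((\<lambda>t. F (z + of_real t * d)) has_vector_derivative F') (at t0)"
proof -
  have "((\<lambda>t. t - t0) has_vector_derivative 1) (at t0)"
    by (auto intro!: derivative_eq_intros)
  moreover have "((\<lambda>t. F (z + of_real t0 * d + of_real t * d)) has_vector_derivative F') (at (t0 - t0))"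
    using assms by (simp add: dir_deriv_def)
  ultimately have "((\<lambda>t. F (z + of_real t0 * d + of_real t * d)) \<circ> (\<lambda>t. t - t0)
      has_vector_derivative 1 *\<^sub>R F') (at t0)"
    by (rule vector_diff_chain_at)
  then show ?thesis by (simp add: o_def algebra_simps)
qed

text \<open>The mean value inequality on a segment; it makes the difference quotients uniformly
  bounded, as dominated convergence requires.\<close>

lemma dir_deriv_increment_bound:
  assumes deriv: "\<And>z. dir_deriv d F (F' z) z" and bound: "\<And>z. cmod (F' z) \<le> B" and "t > 0"
  shows "cmod (F (z + of_real t * d) - F z) \<le> t * B"
proof -
  let ?f = "\<lambda>t. F (z + of_real t * d)"
  have D: "(?f has_vector_derivative F' (z + of_real s * d)) (at s)" for s
    by (intro dir_deriv_along_line deriv)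
  have "continuous_on {0..t} ?f"
    by (rule continuous_on_vector_derivative) (rule has_vector_derivative_at_within[OF D])
  then obtain x where "norm (?f t - ?f 0) \<le> norm ((t - 0) *\<^sub>R F' (z + of_real x * d))"
    using mvt_general[of 0 t ?f "\<lambda>s h. h *\<^sub>R F' (z + of_real s * d)"] D \<open>t > 0\<close>
    unfolding has_vector_derivative_def by blast
  also have "\<dots> \<le> t * B"
    using bound \<open>t > 0\<close> by (simp add: mult_left_mono)
  finally show ?thesis by simp
qed

section \<open>Affine substitutions and integrals of directional derivatives\<close>

lemma lborel_integral_affine:
  fixes f :: "'a::euclidean_space \<Rightarrow> 'b::{banach, second_countable_topology}"
  assumes "f \<in> borel_measurable borel" "c \<noteq> 0"
  shows "(\<integral>x. f x \<partial>lborel) = \<bar>c\<bar> ^ DIM('a) *\<^sub>R (\<integral>x. f (t + c *\<^sub>R x) \<partial>lborel)"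
  using assms
  by (subst lborel_affine[of c t]) (simp_all add: integral_density integral_distr)

lemma lborel_integrable_affine:
  fixes f :: "'a::euclidean_space \<Rightarrow> 'b::{banach, second_countable_topology}"
  assumes f: "integrable lborel f" and c: "c \<noteq> 0"
  shows "integrable lborel (\<lambda>x. f (t + c *\<^sub>R x))"
proof -
  have [measurable]: "f \<in> borel_measurable borel" using f by simp
  have "integrable lborel (\<lambda>x. \<bar>c\<bar> ^ DIM('a) *\<^sub>R f (t + c *\<^sub>R x))"
    using f c by (subst (asm) lborel_affine[of c t])
      (simp_all add: integrable_density integrable_distr_eq)
  then have "integrable lborel (\<lambda>x. inverse (\<bar>c\<bar> ^ DIM('a)) *\<^sub>R (\<bar>c\<bar> ^ DIM('a) *\<^sub>R f (t + c *\<^sub>R x)))"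
    by (rule integrable_scaleR_right)
  then show ?thesis using c by simp
qed

text \<open>The difference quotients integrate to zero by translation invariance.\<close>

lemma integral_dir_deriv_eq_0:
  fixes F :: "complex \<Rightarrow> complex"
  assumes deriv: "\<And>z. dir_deriv d F (F' z) z" and bound: "\<And>z. cmod (F' z) \<le> B"
    and int: "integrable lborel F" and supp: "\<And>z. cmod z > R \<Longrightarrow> F z = 0"
  shows "(\<integral>z. F' z \<partial>lborel) = 0"
proof -
  define t where "t n = inverse (real (Suc n))" for n
  have t: "0 < t n" "t n \<le> 1" for n by (auto simp: t_def field_simps)
  have t0: "t \<longlonglongrightarrow> 0" unfolding t_def by (rule LIMSEQ_inverse_real_of_nat)
  have [measurable]: "F \<in> borel_measurable borel" using int by simp
  let ?q = "\<lambda>n z. (F (z + of_real (t n) * d) - F z) /\<^sub>R t n"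
  have lim: "(\<lambda>n. ?q n z) \<longlonglongrightarrow> F' z" for z
    using deriv[of z, unfolded dir_deriv_iff_tendsto tendsto_at_iff_sequentially, rule_format, of t]
      t(1)[THEN less_imp_neq] t0 by (auto simp: o_def)
  \<comment> \<open>\<open>F'\<close> inherits measurability as a pointwise limit of difference
    quotients.\<close>
  have [measurable]: "F' \<in> borel_measurable borel"
    by (rule borel_measurable_LIMSEQ_metric[OF _ lim]) measurable
  have "(\<lambda>n. \<integral>z. ?q n z \<partial>lborel) \<longlonglongrightarrow> (\<integral>z. F' z \<partial>lborel)"
  proof (rule integral_dominated_convergence)
    \<comment> \<open>Since \<open>t n\<close> is at most 1, a point outside this ball and its shift
      both have modulus above \<open>R\<close>, so the quotient vanishes there.\<close>
    show "integrable lborel (\<lambda>z. B * indicator (cball 0 (\<bar>R\<bar> + cmod d) :: complex set) z :: real)"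
      by (intro integrable_mult_right integrable_real_indicator emeasure_bounded_finite) auto
    show "AE z in lborel. cmod (?q n z) \<le> B * indicator (cball 0 (\<bar>R\<bar> + cmod d)) z" for n
    proof (rule AE_I2)
      fix z
      show "cmod (?q n z) \<le> B * indicator (cball 0 (\<bar>R\<bar> + cmod d)) z"
      proof (cases "z \<in> cball 0 (\<bar>R\<bar> + cmod d)")
        case True
        have "inverse (t n) * cmod (F (z + of_real (t n) * d) - F z) \<le> inverse (t n) * (t n * B)"
          using dir_deriv_increment_bound[OF deriv bound t(1), of z n] t[of n]
          by (intro mult_left_mono) auto
        then show ?thesis
          using True t(1)[of n] by (simp add: mult.assoc[symmetric] less_imp_neq[symmetric])
      next
        case False
        have "cmod (of_real (t n) * d) \<le> cmod d"
          using t[of n] by (simp add: norm_mult mult_left_le_one_le)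
        then have "cmod z > R" "cmod (z + of_real (t n) * d) > R"
          using False norm_diff_ineq[of z "of_real (t n) * d"] norm_ge_zero[of d]
          unfolding mem_cball dist_0_norm by linarith+
        with False show ?thesis by (simp add: supp)
      qed
    qed
  qed (use lim in auto)
  moreover have "(\<integral>z. ?q n z \<partial>lborel) = 0" for n
  proof -
    have "(\<integral>z. F z \<partial>lborel) = (\<integral>z. F (of_real (t n) * d + 1 *\<^sub>R z) \<partial>lborel)"
      by (subst lborel_integral_affine[of F 1 "of_real (t n) * d"]) simp_all
    moreover have "integrable lborel (\<lambda>z. F (of_real (t n) * d + 1 *\<^sub>R z))"
      using int by (rule lborel_integrable_affine) simp
    ultimately show ?thesis
      using int by (simp add: Bochner_Integration.integral_diff add.commute)
  qed
  ultimately have "(\<lambda>n. 0) \<longlonglongrightarrow> (\<integral>z. F' z \<partial>lborel)" by (simp only:)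
  then show ?thesis by (simp add: LIMSEQ_const_iff)
qed

section \<open>Convolution of an integrable function with a bounded kernel\<close>

definition convolve :: "(complex \<Rightarrow> complex) \<Rightarrow> (complex \<Rightarrow> complex) \<Rightarrow> complex \<Rightarrow> complex" where
  "convolve f K z = (\<integral>\<zeta>. f \<zeta> * K (z - \<zeta>) \<partial>lborel)"

lemma integrable_convolve:
  assumes f: "integrable lborel f" and [measurable]: "K \<in> borel_measurable borel"
    and bound: "\<And>z. cmod (K z) \<le> B"
  shows "integrable lborel (\<lambda>\<zeta>. f \<zeta> * K (z - \<zeta>))"
proof (rule Bochner_Integration.integrable_bound)
  show "integrable lborel (\<lambda>\<zeta>. B * norm (f \<zeta>))" using f by simp
  show "AE \<zeta> in lborel. cmod (f \<zeta> * K (z - \<zeta>)) \<le> norm (B * norm (f \<zeta>))"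
  proof (rule AE_I2)
    fix \<zeta>
    have "cmod (f \<zeta> * K (z - \<zeta>)) \<le> B * cmod (f \<zeta>)"
      using mult_left_mono[OF bound[of "z - \<zeta>"], of "cmod (f \<zeta>)"] by (simp add: norm_mult mult.commute)
    then show "cmod (f \<zeta> * K (z - \<zeta>)) \<le> norm (B * norm (f \<zeta>))" by simp
  qed
  have [measurable]: "f \<in> borel_measurable borel" using f by simp
  show "(\<lambda>\<zeta>. f \<zeta> * K (z - \<zeta>)) \<in> borel_measurable lborel" by simp
qed

lemma convolve_bound:
  assumes f: "integrable lborel f" and "K \<in> borel_measurable borel"
    and bound: "\<And>z. cmod (K z) \<le> B"
  shows "cmod (convolve f K z) \<le> B * (\<integral>\<zeta>. cmod (f \<zeta>) \<partial>lborel)"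
proof -
  have "cmod (convolve f K z) \<le> (\<integral>\<zeta>. B * cmod (f \<zeta>) \<partial>lborel)"
    unfolding convolve_def
  proof (rule Bochner_Integration.integral_norm_bound_integral)
    show "cmod (f \<zeta> * K (z - \<zeta>)) \<le> B * cmod (f \<zeta>)" for \<zeta>
      using mult_left_mono[OF bound[of "z - \<zeta>"], of "cmod (f \<zeta>)"] by (simp add: norm_mult mult.commute)
  qed (use f integrable_convolve[OF assms] in auto)
  then show ?thesis by simp
qed

text \<open>The Lipschitz constant bounds all difference quotients of the kernel, so a multiple of
  |f| dominates and the derivative falls on the kernel; \<open>f\<close> itself is merely
  integrable.\<close>

lemma dir_deriv_convolve:
  assumes f: "integrable lborel f" and K: "continuous_on UNIV K" and bound: "\<And>z. cmod (K z) \<le> B"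
    and lip: "\<And>z w. cmod (K z - K w) \<le> L * cmod (z - w)"
    and deriv: "\<And>z. dir_deriv d K (K' z) z"
  shows "dir_deriv d (convolve f K) (convolve f K' z) z"
  unfolding dir_deriv_iff_tendsto tendsto_at_iff_sequentially
proof (intro allI impI)
  fix X :: "nat \<Rightarrow> real"
  assume X: "\<forall>i. X i \<in> UNIV - {0}" "X \<longlonglongrightarrow> 0"
  have [measurable]: "f \<in> borel_measurable borel" "K \<in> borel_measurable borel"
    using f K by (simp_all add: borel_measurable_continuous_onI)
  let ?q = "\<lambda>n \<zeta>. (K (z - \<zeta> + of_real (X n) * d) - K (z - \<zeta>)) /\<^sub>R X n"
  have lim: "(\<lambda>n. ?q n \<zeta>) \<longlonglongrightarrow> K' (z - \<zeta>)" for \<zeta>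
    using deriv[of "z - \<zeta>", unfolded dir_deriv_iff_tendsto tendsto_at_iff_sequentially, rule_format, of X]
      X by (auto simp: o_def)
  have [measurable]: "(\<lambda>\<zeta>. K' (z - \<zeta>)) \<in> borel_measurable borel"
    by (rule borel_measurable_LIMSEQ_metric[OF _ lim]) measurable
  have "(\<lambda>n. \<integral>\<zeta>. f \<zeta> * ?q n \<zeta> \<partial>lborel) \<longlonglongrightarrow> (\<integral>\<zeta>. f \<zeta> * K' (z - \<zeta>) \<partial>lborel)"
  proof (rule integral_dominated_convergence)
    show "integrable lborel (\<lambda>\<zeta>. L * cmod d * cmod (f \<zeta>))" using f by simp
    show "AE \<zeta> in lborel. (\<lambda>n. f \<zeta> * ?q n \<zeta>) \<longlonglongrightarrow> f \<zeta> * K' (z - \<zeta>)"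
      by (intro AE_I2 tendsto_mult tendsto_const lim)
    show "AE \<zeta> in lborel. cmod (f \<zeta> * ?q n \<zeta>) \<le> L * cmod d * cmod (f \<zeta>)" for n
    proof (rule AE_I2)
      fix \<zeta>
      have "cmod (K (z - \<zeta> + of_real (X n) * d) - K (z - \<zeta>)) \<le> L * (\<bar>X n\<bar> * cmod d)"
        using lip[of "z - \<zeta> + of_real (X n) * d" "z - \<zeta>"] by (simp add: norm_mult)
      moreover have "\<bar>X n\<bar> > 0" using X(1) by simp
      ultimately have "cmod (K (z - \<zeta> + of_real (X n) * d) - K (z - \<zeta>)) / \<bar>X n\<bar> \<le> L * cmod d"
        by (simp add: pos_divide_le_eq mult_ac)
      then have "cmod (?q n \<zeta>) \<le> L * cmod d"
        by (simp add: divide_inverse mult.commute)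
      then have "cmod (f \<zeta>) * cmod (?q n \<zeta>) \<le> cmod (f \<zeta>) * (L * cmod d)"
        by (rule mult_left_mono) simp
      then show "cmod (f \<zeta> * ?q n \<zeta>) \<le> L * cmod d * cmod (f \<zeta>)"
        unfolding norm_mult by (simp only: mult.commute)
    qed
  qed simp_all
  moreover have "(convolve f K (z + of_real (X n) * d) - convolve f K z) /\<^sub>R X n = (\<integral>\<zeta>. f \<zeta> * ?q n \<zeta> \<partial>lborel)" for n
  proof -
    have "convolve f K (z + of_real (X n) * d) - convolve f K z
      = (\<integral>\<zeta>. f \<zeta> * K (z + of_real (X n) * d - \<zeta>) - f \<zeta> * K (z - \<zeta>) \<partial>lborel)"
      unfolding convolve_def
      by (rule Bochner_Integration.integral_diff[symmetric])
        (auto intro!: integrable_convolve[OF f _ bound])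
    also have "\<dots> /\<^sub>R X n = (\<integral>\<zeta>. (f \<zeta> * K (z + of_real (X n) * d - \<zeta>) - f \<zeta> * K (z - \<zeta>)) /\<^sub>R X n \<partial>lborel)"
      by simp
    also have "\<dots> = (\<integral>\<zeta>. f \<zeta> * ?q n \<zeta> \<partial>lborel)"
      by (intro Bochner_Integration.integral_cong refl) (simp add: algebra_simps)
    finally show ?thesis .
  qed
  ultimately show "((\<lambda>t. (convolve f K (z + of_real t * d) - convolve f K z) /\<^sub>R t) \<circ> X) \<longlonglongrightarrow> convolve f K' z"
    unfolding o_def convolve_def[of f K'] by (simp only:)
qed

section \<open>The regularised Cauchy kernel\<close>

text \<open>For \<delta> = 0 and z nonzero this is cnj z / |z|^2 = 1/z, the Cauchy kernel without
  its factor 1/\<pi>.\<close>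

definition reg_kernel :: "real \<Rightarrow> complex \<Rightarrow> complex" where
  "reg_kernel \<delta> z = cnj z / of_real ((cmod z)\<^sup>2 + \<delta>\<^sup>2)"

definition approx_identity :: "real \<Rightarrow> complex \<Rightarrow> real" where
  "approx_identity \<delta> z = \<delta>\<^sup>2 / ((cmod z)\<^sup>2 + \<delta>\<^sup>2)\<^sup>2"

text \<open>The modulus of 1/z minus \<open>reg_kernel\<close>, for z nonzero and \<delta> > 0. At z
  = 0 division by zero makes it 0.\<close>

definition kernel_defect :: "real \<Rightarrow> complex \<Rightarrow> real" where
  "kernel_defect \<delta> z = \<delta>\<^sup>2 / (cmod z * ((cmod z)\<^sup>2 + \<delta>\<^sup>2))"

lemma measurable_kernels [measurable]:
  "reg_kernel \<delta> \<in> borel_measurable borel"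
  "approx_identity \<delta> \<in> borel_measurable borel"
  "kernel_defect \<delta> \<in> borel_measurable borel"
proof -
  have [measurable]: "cnj \<in> borel_measurable borel"
    by (intro borel_measurable_continuous_onI continuous_intros)
  show "reg_kernel \<delta> \<in> borel_measurable borel"
    unfolding reg_kernel_def[abs_def] by measurable
  show "approx_identity \<delta> \<in> borel_measurable borel"
    unfolding approx_identity_def[abs_def] by measurable
  show "kernel_defect \<delta> \<in> borel_measurable borel"
    unfolding kernel_defect_def[abs_def] by measurable
qed

lemma kernels_nonneg [simp]: "0 \<le> approx_identity \<delta> z" "0 \<le> kernel_defect \<delta> z"
  by (simp_all add: approx_identity_def kernel_defect_def)

section \<open>Bounds, derivatives and scaling of the kernels at a fixed positive scale\<close>

context
  fixes \<delta> :: real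
  assumes \<delta>: "\<delta> > 0"
begin

lemma denom_pos: "(cmod z)\<^sup>2 + \<delta>\<^sup>2 > 0"
  using \<delta> by (simp add: add_nonneg_pos)

lemma denom_nonzero: "(cmod z)\<^sup>2 + \<delta>\<^sup>2 \<noteq> 0"
  using denom_pos[of z] by linarith

lemma norm_of_real_denom: "cmod (of_real ((cmod z)\<^sup>2 + \<delta>\<^sup>2)) = (cmod z)\<^sup>2 + \<delta>\<^sup>2"
  using denom_pos[of z] by (simp only: norm_of_real abs_of_pos)

text \<open>From the nonnegative square of |z| - \<delta> one gets |z|\<delta> \<le> |z|^2 +
  \<delta>^2.\<close>

lemma reg_kernel_bound: "cmod (reg_kernel \<delta> z) \<le> 1 / \<delta>"
proof -
  have "0 \<le> (cmod z - \<delta>)\<^sup>2" "0 \<le> cmod z * \<delta>" using \<delta> by simp_all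
  then have "cmod z * \<delta> \<le> (cmod z)\<^sup>2 + \<delta>\<^sup>2" unfolding power2_diff by linarith
  then show ?thesis
    using denom_pos[of z] \<delta>
    by (simp add: reg_kernel_def norm_divide norm_of_real_denom divide_simps del: of_real_add)
qed

lemma approx_identity_bound: "approx_identity \<delta> z \<le> 1 / \<delta>\<^sup>2"
proof -
  have "(\<delta>\<^sup>2)\<^sup>2 \<le> ((cmod z)\<^sup>2 + \<delta>\<^sup>2)\<^sup>2" by (intro power_mono) auto
  then show ?thesis
    using denom_pos[of z] \<delta>
    by (simp add: approx_identity_def divide_simps power2_eq_square)
qed

text \<open>Since |z|^2 = z cnj z, cross-multiplication leaves a numerator with a factor z - w or
  its conjugate in each term. Both the Lipschitz constant and the derivative are read off from this
  form.\<close>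

lemma reg_kernel_diff:
  "reg_kernel \<delta> z - reg_kernel \<delta> w =
    (of_real (\<delta>\<^sup>2) * cnj (z - w) - cnj z * cnj w * (z - w))
      / of_real (((cmod z)\<^sup>2 + \<delta>\<^sup>2) * ((cmod w)\<^sup>2 + \<delta>\<^sup>2))"
proof -
  define Nz Nw :: complex where "Nz = of_real ((cmod z)\<^sup>2 + \<delta>\<^sup>2)" and "Nw = of_real ((cmod w)\<^sup>2 + \<delta>\<^sup>2)"
  have nz: "Nz \<noteq> 0" "Nw \<noteq> 0"
    using denom_pos[of z] denom_pos[of w] unfolding Nz_def Nw_def of_real_eq_0_iff by linarith+
  have "Nz = z * cnj z + of_real (\<delta>\<^sup>2)" "Nw = w * cnj w + of_real (\<delta>\<^sup>2)"
    unfolding Nz_def Nw_def of_real_add complex_norm_square by (rule refl)+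
  then have "cnj z * Nw - cnj w * Nz = of_real (\<delta>\<^sup>2) * cnj (z - w) - cnj z * cnj w * (z - w)"
    by (simp add: algebra_simps)
  then show ?thesis
    using nz unfolding reg_kernel_def of_real_mult Nz_def[symmetric] Nw_def[symmetric]
    by (simp add: diff_frac_eq)
qed

lemma reg_kernel_lipschitz:
  "cmod (reg_kernel \<delta> z - reg_kernel \<delta> w) \<le> 2 / \<delta>\<^sup>2 * cmod (z - w)"
proof -
  define Nz Nw where "Nz = (cmod z)\<^sup>2 + \<delta>\<^sup>2" and "Nw = (cmod w)\<^sup>2 + \<delta>\<^sup>2"
  have pos: "Nz > 0" "Nw > 0" using denom_pos by (simp_all add: Nz_def Nw_def)
  have le: "\<delta>\<^sup>2 \<le> Nz" "\<delta>\<^sup>2 \<le> Nw" by (simp_all add: Nz_def Nw_def)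
  have "cmod z * \<delta> \<le> Nz" "cmod w * \<delta> \<le> Nw"
    using zero_le_power2[of "cmod z - \<delta>"] zero_le_power2[of "cmod w - \<delta>"]
      mult_nonneg_nonneg[OF norm_ge_zero less_imp_le[OF \<delta>], of z] mult_nonneg_nonneg[OF norm_ge_zero less_imp_le[OF \<delta>], of w]
    unfolding power2_diff Nz_def Nw_def by linarith+
  \<comment> \<open>The two terms of the numerator are estimated separately, each by
    \<open>Nz * Nw\<close> after multiplication by \<delta>^2; this produces the constant 2.\<close>
  then have "(cmod z * \<delta>) * (cmod w * \<delta>) \<le> Nz * Nw"
    using \<delta> pos by (intro mult_mono) auto
  moreover have "\<delta>\<^sup>2 * \<delta>\<^sup>2 \<le> Nz * Nw"
    using le pos by (intro mult_mono) auto
  ultimately have "(\<delta>\<^sup>2 + cmod z * cmod w) * \<delta>\<^sup>2 \<le> 2 * (Nz * Nw)"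
    by (simp add: algebra_simps power2_eq_square)
  then have *: "(\<delta>\<^sup>2 + cmod z * cmod w) / (Nz * Nw) \<le> 2 / \<delta>\<^sup>2"
    using pos \<delta> by (simp add: divide_simps mult_pos_pos)
  have "cmod (of_real (\<delta>\<^sup>2) * cnj (z - w) - cnj z * cnj w * (z - w))
      \<le> cmod (of_real (\<delta>\<^sup>2) * cnj (z - w)) + cmod (cnj z * cnj w * (z - w))"
    by (rule norm_triangle_ineq4)
  also have "\<dots> = (\<delta>\<^sup>2 + cmod z * cmod w) * cmod (z - w)"
    by (simp only: norm_mult norm_of_real complex_mod_cnj) (simp add: algebra_simps)
  finally have "cmod (reg_kernel \<delta> z - reg_kernel \<delta> w)
      \<le> (\<delta>\<^sup>2 + cmod z * cmod w) * cmod (z - w) / (Nz * Nw)"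
    using pos unfolding reg_kernel_diff Nz_def[symmetric] Nw_def[symmetric] norm_divide norm_of_real
    by (simp add: divide_right_mono abs_mult)
  also have "\<dots> = (\<delta>\<^sup>2 + cmod z * cmod w) / (Nz * Nw) * cmod (z - w)" by simp
  also have "\<dots> \<le> 2 / \<delta>\<^sup>2 * cmod (z - w)"
    using * by (rule mult_right_mono) simp
  finally show ?thesis .
qed

lemma continuous_on_reg_kernel: "continuous_on UNIV (reg_kernel \<delta>)"
  unfolding reg_kernel_def[abs_def]
  by (intro continuous_intros) (use denom_nonzero in \<open>simp only: of_real_eq_0_iff simp_thms ball_UNIV\<close>)

text \<open>The limit of the difference formula when the two points merge along \<open>d\<close>.
  The coefficient of cnj d is the derivative with respect to cnj z, that of d the derivative with
  respect to z.\<close>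

definition reg_kernel_deriv :: "complex \<Rightarrow> complex \<Rightarrow> complex" where
  "reg_kernel_deriv d z = (of_real (\<delta>\<^sup>2) * cnj d - (cnj z)\<^sup>2 * d) / of_real (((cmod z)\<^sup>2 + \<delta>\<^sup>2)\<^sup>2)"

lemma dir_deriv_reg_kernel: "dir_deriv d (reg_kernel \<delta>) (reg_kernel_deriv d z) z"
proof -
  let ?w = "\<lambda>t::real. z + of_real t * d"
  \<comment> \<open>The factor t cancels, and what remains is continuous at t = 0, so the limit is
    obtained by substitution.\<close>
  have eq: "(of_real (\<delta>\<^sup>2) * cnj d - cnj (?w t) * cnj z * d)
      / of_real (((cmod (?w t))\<^sup>2 + \<delta>\<^sup>2) * ((cmod z)\<^sup>2 + \<delta>\<^sup>2)) = (reg_kernel \<delta> (?w t) - reg_kernel \<delta> z) /\<^sub>R t"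
    if "t \<noteq> 0" for t
  proof -
    have "of_real (\<delta>\<^sup>2) * cnj (?w t - z) - cnj (?w t) * cnj z * (?w t - z)
       = of_real t * (of_real (\<delta>\<^sup>2) * cnj d - cnj (?w t) * cnj z * d)"
      by (simp add: algebra_simps)
    then show ?thesis
      using that unfolding reg_kernel_diff by (simp add: scaleR_conv_of_real)
  qed
  have "((\<lambda>t. (of_real (\<delta>\<^sup>2) * cnj d - cnj (?w t) * cnj z * d)
      / of_real (((cmod (?w t))\<^sup>2 + \<delta>\<^sup>2) * ((cmod z)\<^sup>2 + \<delta>\<^sup>2))) \<longlongrightarrow>
     (of_real (\<delta>\<^sup>2) * cnj d - cnj (z + of_real 0 * d) * cnj z * d)
      / of_real (((cmod (z + of_real 0 * d))\<^sup>2 + \<delta>\<^sup>2) * ((cmod z)\<^sup>2 + \<delta>\<^sup>2))) (at 0)"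
    by (intro tendsto_intros) (use denom_nonzero in \<open>simp only: of_real_eq_0_iff mult_eq_0_iff simp_thms\<close>)
  then have "((\<lambda>t. (reg_kernel \<delta> (?w t) - reg_kernel \<delta> z) /\<^sub>R t) \<longlongrightarrow>
     (of_real (\<delta>\<^sup>2) * cnj d - cnj (z + of_real 0 * d) * cnj z * d)
      / of_real (((cmod (z + of_real 0 * d))\<^sup>2 + \<delta>\<^sup>2) * ((cmod z)\<^sup>2 + \<delta>\<^sup>2))) (at 0)"
    by (rule Lim_transform_eventually)
      (unfold eventually_at_filter, intro always_eventually allI impI eq)
  then show ?thesis
    unfolding dir_deriv_iff_tendsto
    by (rule tendsto_eq_rhs) (simp add: reg_kernel_deriv_def power2_eq_square)
qed

text \<open>Adding direction 1 and \<i> times direction \<i> cancels the terms linear in d, since 1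
  + \<i>\<i> = 0, and doubles those in cnj d.\<close>

lemma dbar_reg_kernel:
  "(reg_kernel_deriv 1 z + \<i> * reg_kernel_deriv \<i> z) / 2 = of_real (approx_identity \<delta> z)"
proof -
  define N where "N = (cmod z)\<^sup>2 + \<delta>\<^sup>2"
  have "N \<noteq> 0" using denom_nonzero by (simp add: N_def)
  then show ?thesis
    unfolding reg_kernel_deriv_def approx_identity_def N_def[symmetric] by (simp add: field_simps)
qed

text \<open>The Lipschitz constant bounds the difference quotients, and the bound survives the
  limit.\<close>

lemma reg_kernel_deriv_bound: "cmod (reg_kernel_deriv d z) \<le> 2 / \<delta>\<^sup>2 * cmod d"
proof (rule tendsto_upperbound)
  show "((\<lambda>t. norm ((reg_kernel \<delta> (z + of_real t * d) - reg_kernel \<delta> z) /\<^sub>R t))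
     \<longlongrightarrow> cmod (reg_kernel_deriv d z)) (at 0)"
    using dir_deriv_reg_kernel unfolding dir_deriv_iff_tendsto by (rule tendsto_norm)
  have "norm ((reg_kernel \<delta> (z + of_real t * d) - reg_kernel \<delta> z) /\<^sub>R t) \<le> 2 / \<delta>\<^sup>2 * cmod d" if "t \<noteq> 0" for t
  proof -
    have "cmod (reg_kernel \<delta> (z + of_real t * d) - reg_kernel \<delta> z) \<le> 2 / \<delta>\<^sup>2 * (\<bar>t\<bar> * cmod d)"
      using reg_kernel_lipschitz[of "z + of_real t * d" z] by (simp add: norm_mult)
    then have "inverse \<bar>t\<bar> * cmod (reg_kernel \<delta> (z + of_real t * d) - reg_kernel \<delta> z)
       \<le> inverse \<bar>t\<bar> * (2 / \<delta>\<^sup>2 * (\<bar>t\<bar> * cmod d))"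
      by (rule mult_left_mono) simp
    moreover have "inverse \<bar>t\<bar> * (2 / \<delta>\<^sup>2 * (\<bar>t\<bar> * cmod d)) = 2 / \<delta>\<^sup>2 * cmod d"
      using that by (simp add: field_simps)
    ultimately show ?thesis unfolding norm_scaleR abs_inverse by (simp only:)
  qed
  then show "\<forall>\<^sub>F t in at 0. norm ((reg_kernel \<delta> (z + of_real t * d) - reg_kernel \<delta> z) /\<^sub>R t) \<le> 2 / \<delta>\<^sup>2 * cmod d"
    by (simp add: eventually_at_filter)
qed simp

lemma continuous_on_reg_kernel_deriv: "continuous_on UNIV (reg_kernel_deriv d)"
  unfolding reg_kernel_deriv_def[abs_def]
  by (intro continuous_intros)
    (use denom_nonzero in \<open>simp only: of_real_eq_0_iff power_eq_0_iff simp_thms ball_UNIV\<close>)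

lemma reg_kernel_minus_cauchy:
  assumes "z \<noteq> 0"
  shows "cmod (1 / z - reg_kernel \<delta> z) = kernel_defect \<delta> z"
proof -
  define N where "N = (cmod z)\<^sup>2 + \<delta>\<^sup>2"
  have N: "N > 0" using denom_pos by (simp add: N_def)
  have "1 / z - reg_kernel \<delta> z = (of_real N - z * cnj z) / (z * of_real N)"
    using assms N unfolding reg_kernel_def N_def[symmetric] by (simp add: field_simps)
  also have "of_real N - z * cnj z = of_real (\<delta>\<^sup>2)"
    unfolding N_def of_real_add complex_norm_square by simp
  finally show ?thesis
    using N by (simp add: norm_divide norm_mult kernel_defect_def N_def[symmetric] norm_power)
qed

text \<open>The factor \<delta>^(-2) is the inverse Jacobian of a planar dilation, so the total mass
  does not depend on \<delta>.\<close>

lemma approx_identity_scale: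
  "approx_identity \<delta> (\<delta> *\<^sub>R z) = approx_identity 1 z / \<delta>\<^sup>2"
proof -
  have "(cmod (\<delta> *\<^sub>R z))\<^sup>2 + \<delta>\<^sup>2 = \<delta>\<^sup>2 * ((cmod z)\<^sup>2 + 1)"
    by (simp add: power_mult_distrib algebra_simps)
  then show ?thesis
    using \<delta> unfolding approx_identity_def by (simp add: power_mult_distrib power2_eq_square)
qed

text \<open>The minus sign fits the substitution \<zeta> = z + \<delta>\<eta>, under which z -
  \<zeta> becomes -\<delta>\<eta>.\<close>

lemma kernel_defect_scale:
  "kernel_defect \<delta> ((- \<delta>) *\<^sub>R z) = kernel_defect 1 z / \<delta>"
proof -
  have "(cmod ((- \<delta>) *\<^sub>R z))\<^sup>2 + \<delta>\<^sup>2 = \<delta>\<^sup>2 * ((cmod z)\<^sup>2 + 1)"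
    by (simp add: power_mult_distrib algebra_simps)
  then show ?thesis
    using \<delta> unfolding kernel_defect_def by (simp add: power_mult_distrib power2_eq_square)
qed

text \<open>Homogeneity contributes \<delta>^(-p) and the planar Jacobian \<delta>^2. The resulting
  power \<delta>^(2-p) tends to 0 with \<delta> because p < 2, and it is independent of z.\<close>

lemma kernel_defect_powr_integral:
  assumes "1 < p" "p < 2"
  shows "integrable lborel (\<lambda>\<zeta>. kernel_defect \<delta> (z - \<zeta>) powr p)"
    and "(\<integral>\<zeta>. kernel_defect \<delta> (z - \<zeta>) powr p \<partial>lborel)
      = \<delta> powr (2 - p) * (\<integral>\<zeta>. kernel_defect 1 \<zeta> powr p \<partial>lborel)"
proof -
  have base: "integrable lborel (\<lambda>\<zeta>. kernel_defect 1 \<zeta> powr p)"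
    using integrable_cauchy_defect[OF assms] by (simp add: kernel_defect_def add.commute)
  have "kernel_defect \<delta> \<zeta> powr p = \<delta> powr (-p) * kernel_defect 1 ((0 + (- 1 / \<delta>) *\<^sub>R \<zeta>)) powr p" for \<zeta>
    using kernel_defect_scale[of "(- 1 / \<delta>) *\<^sub>R \<zeta>"] \<delta>
    by (simp add: powr_divide powr_minus_divide)
  moreover have "integrable lborel (\<lambda>\<zeta>. \<delta> powr (-p) * kernel_defect 1 ((0 + (- 1 / \<delta>) *\<^sub>R \<zeta>)) powr p)"
    using lborel_integrable_affine[OF base, of "- 1 / \<delta>" 0] \<delta> by simp
  ultimately have int: "integrable lborel (\<lambda>\<zeta>. kernel_defect \<delta> \<zeta> powr p)" by simp
  show "integrable lborel (\<lambda>\<zeta>. kernel_defect \<delta> (z - \<zeta>) powr p)"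
    using lborel_integrable_affine[OF int, of "-1" z] by simp
  have "(\<integral>\<zeta>. kernel_defect \<delta> (z - \<zeta>) powr p \<partial>lborel)
    = \<bar>\<delta>\<bar> ^ DIM(complex) *\<^sub>R (\<integral>\<zeta>. kernel_defect \<delta> (z - (z + \<delta> *\<^sub>R \<zeta>)) powr p \<partial>lborel)"
    using \<delta> by (intro lborel_integral_affine) auto
  also have "(\<integral>\<zeta>. kernel_defect \<delta> (z - (z + \<delta> *\<^sub>R \<zeta>)) powr p \<partial>lborel)
      = (\<integral>\<zeta>. \<delta> powr (-p) * kernel_defect 1 \<zeta> powr p \<partial>lborel)"
    using kernel_defect_scale \<delta>
    by (intro Bochner_Integration.integral_cong refl) (simp add: powr_divide powr_minus_divide)
  also have "\<bar>\<delta>\<bar> ^ DIM(complex) *\<^sub>R \<dots> = \<delta> powr 2 * \<delta> powr (-p) * (\<integral>\<zeta>. kernel_defect 1 \<zeta> powr p \<partial>lborel)"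
    using \<delta> by simp
  also have "\<delta> powr 2 * \<delta> powr (-p) = \<delta> powr (2 - p)"
    using \<delta> by (simp only: powr_add[symmetric]) simp
  finally show "(\<integral>\<zeta>. kernel_defect \<delta> (z - \<zeta>) powr p \<partial>lborel)
      = \<delta> powr (2 - p) * (\<integral>\<zeta>. kernel_defect 1 \<zeta> powr p \<partial>lborel)" .
qed

end

text \<open>Both kernels are compared with 1/z; at z = 0 both vanish.\<close>

lemma reg_kernel_diff_le_defects:
  assumes "\<delta> > 0" "\<epsilon> > 0"
  shows "cmod (reg_kernel \<delta> z - reg_kernel \<epsilon> z) \<le> kernel_defect \<delta> z + kernel_defect \<epsilon> z"
proof (cases "z = 0")
  case False
  have "reg_kernel \<delta> z - reg_kernel \<epsilon> z = (1 / z - reg_kernel \<epsilon> z) - (1 / z - reg_kernel \<delta> z)" by simp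
  then show ?thesis
    using norm_triangle_ineq4[of "1 / z - reg_kernel \<epsilon> z" "1 / z - reg_kernel \<delta> z"]
    by (simp add: reg_kernel_minus_cauchy[OF _ False] assms)
qed (simp add: reg_kernel_def)

section \<open>Mass of the approximate identity, and continuous functions of compact support\<close>

lemma integrable_approx_identity_1: "integrable lborel (approx_identity 1)"
  using integrable_inverse_square_decay by (simp add: approx_identity_def[abs_def] add.commute)

text \<open>The value is \<pi>. It is kept as a constant because dividing the datum by it asks for
  positivity alone.\<close>

definition approx_mass :: real where
  "approx_mass = (\<integral>z. approx_identity 1 z \<partial>lborel)"

lemma approx_mass_pos: "approx_mass > 0"
proof -
  have "0 \<le> approx_mass" by (simp add: approx_mass_def)
  moreover have "approx_mass \<noteq> 0"
  proof
    assume "approx_mass = 0"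
    then have "AE z in lborel. approx_identity 1 z = 0"
      using integral_nonneg_eq_0_iff_AE[OF integrable_approx_identity_1] by (simp add: approx_mass_def)
    then have "AE z in (lborel::complex measure). False"
      by eventually_elim (simp add: approx_identity_def add_nonneg_eq_0_iff)
    then show False by (simp add: eventually_False[symmetric] AE_iff_null null_sets_def)
  qed
  ultimately show ?thesis by simp
qed

lemma bounded_compact_support:
  fixes g :: "complex \<Rightarrow> complex"
  assumes g: "continuous_on UNIV g" and supp: "\<And>z. cmod z > R \<Longrightarrow> g z = 0"
  obtains B where "B \<ge> 0" "\<And>z. cmod (g z) \<le> B"
proof -
  have "bounded (g ` cball 0 R)"
    using g by (intro compact_imp_bounded compact_continuous_image continuous_on_subset[OF g]) auto
  then obtain B where "B > 0" and B: "\<And>z. cmod z \<le> R \<Longrightarrow> cmod (g z) \<le> B"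
    unfolding bounded_pos by auto
  then have "cmod (g z) \<le> B" for z
    by (cases "cmod z \<le> R") (auto simp: supp)
  then show ?thesis using that[of B] \<open>B > 0\<close> by auto
qed

lemma integrable_compact_support:
  fixes g :: "complex \<Rightarrow> complex"
  assumes g: "continuous_on UNIV g" and supp: "\<And>z. cmod z > R \<Longrightarrow> g z = 0"
  shows "integrable lborel g"
proof -
  have "integrable lborel (\<lambda>z. indicator (cball 0 R) z *\<^sub>R g z)"
    by (rule borel_integrable_compact) (auto intro: continuous_on_subset[OF g])
  moreover have "indicator (cball 0 R) z *\<^sub>R g z = g z" for z
    using supp[of z] by (auto simp: indicator_def)
  ultimately show ?thesis by simp
qed

lemma continuous_on_convolve:
  assumes f: "integrable lborel f" and K: "continuous_on UNIV K" and bound: "\<And>z. cmod (K z) \<le> B"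
  shows "continuous_on UNIV (convolve f K)"
proof -
  have [measurable]: "f \<in> borel_measurable borel" "K \<in> borel_measurable borel"
    using f K by (simp_all add: borel_measurable_continuous_onI)
  show ?thesis
    unfolding continuous_on_sequentially
  proof (intro ballI allI impI, elim conjE)
    fix X :: "nat \<Rightarrow> complex" and a assume X: "X \<longlonglongrightarrow> a"
    have "(\<lambda>n. \<integral>\<zeta>. f \<zeta> * K (X n - \<zeta>) \<partial>lborel) \<longlonglongrightarrow> (\<integral>\<zeta>. f \<zeta> * K (a - \<zeta>) \<partial>lborel)"
    proof (rule integral_dominated_convergence)
      show "integrable lborel (\<lambda>\<zeta>. B * cmod (f \<zeta>))" using f by simp
      show "AE \<zeta> in lborel. (\<lambda>n. f \<zeta> * K (X n - \<zeta>)) \<longlonglongrightarrow> f \<zeta> * K (a - \<zeta>)"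
        using K X by (intro AE_I2 tendsto_mult tendsto_const)
          (auto intro!: tendsto_intros continuous_on_tendsto_compose[OF K])
      show "AE \<zeta> in lborel. cmod (f \<zeta> * K (X n - \<zeta>)) \<le> B * cmod (f \<zeta>)" for n
        using mult_left_mono[OF bound norm_ge_zero]
        by (intro AE_I2) (simp add: norm_mult mult.commute)
    qed simp_all
    then show "(convolve f K \<circ> X) \<longlonglongrightarrow> convolve f K a"
      by (simp add: o_def convolve_def)
  qed
qed

text \<open>Young's inequality with weight \<open>e\<close>, to be chosen as a power of \<open>\<delta>\<close>.\<close>

lemma integral_kernel_defect_bound:
  fixes f :: "complex \<Rightarrow> complex"
  assumes pq: "q > 2" "p = q / (q - 1)" and \<delta>: "\<delta> > 0"
    and f: "f \<in> borel_measurable borel" and fq: "integrable lborel (\<lambda>z. cmod (f z) powr q)"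
  shows "integrable lborel (\<lambda>\<zeta>. cmod (f \<zeta>) * kernel_defect \<delta> (z - \<zeta>))" (is ?I)
    and "(\<integral>\<zeta>. cmod (f \<zeta>) * kernel_defect \<delta> (z - \<zeta>) \<partial>lborel)
      \<le> \<delta> powr ((2 - p) / (2 * p) * q) * (\<integral>z. cmod (f z) powr q \<partial>lborel)
        + \<delta> powr ((2 - p) / 2) * (\<integral>z. kernel_defect 1 z powr p \<partial>lborel)" (is "_ \<le> ?rate")
proof -
  have p: "1 < p" "p < 2" "1 / q + 1 / p = 1"
    unfolding pq(2) using pq(1) by (auto simp: field_simps)
  \<comment> \<open>This weight spends half of the decay: \<open>e powr (-p)\<close> lowers the
    exponent 2 - p of \<delta> to (2 - p)/2, while \<open>e powr q\<close> is still a positive power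
    of \<delta>.\<close>
  define e where "e = \<delta> powr ((2 - p) / (2 * p))"
  have e: "e > 0" using \<delta> by (simp add: e_def)
  note D = kernel_defect_powr_integral[OF \<delta> p(1,2)]
  let ?Y = "\<lambda>\<zeta>. e powr q * cmod (f \<zeta>) powr q + e powr (-p) * kernel_defect \<delta> (z - \<zeta>) powr p"
  have Y: "integrable lborel ?Y"
    using fq D(1) by simp
  have shrink: "x / r \<le> x" if "0 \<le> x" "1 < r" for x r :: real
    using that by (simp add: divide_le_eq mult_le_cancel_left1)
  have le: "cmod (f \<zeta>) * kernel_defect \<delta> (z - \<zeta>) \<le> ?Y \<zeta>" for \<zeta>
  proof -
    have "cmod (f \<zeta>) * kernel_defect \<delta> (z - \<zeta>) = (e * cmod (f \<zeta>)) * (kernel_defect \<delta> (z - \<zeta>) / e)"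
      using e by simp
    also have "\<dots> \<le> (e * cmod (f \<zeta>)) powr q / q + (kernel_defect \<delta> (z - \<zeta>) / e) powr p / p"
      using e pq p by (intro Youngs_inequality) auto
    also have "\<dots> \<le> (e * cmod (f \<zeta>)) powr q + (kernel_defect \<delta> (z - \<zeta>) / e) powr p"
      using pq p by (intro add_mono shrink) auto
    also have "\<dots> = ?Y \<zeta>"
      using e by (simp add: powr_mult powr_divide powr_minus_divide)
    finally show ?thesis .
  qed
  show I: ?I
    by (rule Bochner_Integration.integrable_bound[OF Y])
      (use f le in \<open>auto intro!: AE_I2 order_trans[OF le] simp: abs_mult\<close>)
  have "(\<integral>\<zeta>. cmod (f \<zeta>) * kernel_defect \<delta> (z - \<zeta>) \<partial>lborel) \<le> (\<integral>\<zeta>. ?Y \<zeta> \<partial>lborel)"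
    using I Y le by (rule integral_mono)
  also have "\<dots> = e powr q * (\<integral>z. cmod (f z) powr q \<partial>lborel)
      + (e powr (-p) * \<delta> powr (2 - p)) * (\<integral>z. kernel_defect 1 z powr p \<partial>lborel)"
    using fq D by simp
  also have "e powr q = \<delta> powr ((2 - p) / (2 * p) * q)"
    by (simp add: e_def powr_powr)
  also have "e powr (-p) * \<delta> powr (2 - p) = \<delta> powr ((2 - p) / 2)"
  proof -
    have "(2 - p) / (2 * p) * (-p) + (2 - p) = (2 - p) / 2"
      using p by (simp add: field_simps)
    then show ?thesis
      by (simp only: e_def powr_powr powr_add[symmetric])
  qed
  finally show "(\<integral>\<zeta>. cmod (f \<zeta>) * kernel_defect \<delta> (z - \<zeta>) \<partial>lborel) \<le> ?rate" .
qed

text \<open>Two convolutions differ by at most the sum of their defect integrals. The rate bounding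
  these does not involve z and tends to 0, so the sequence is uniformly Cauchy.\<close>

lemma uniform_limit_convolve_reg_kernel:
  fixes f :: "complex \<Rightarrow> complex"
  defines "\<delta> \<equiv> \<lambda>n. inverse (real (Suc n))"
  assumes q: "q > 2" and f: "integrable lborel f" and fq: "integrable lborel (\<lambda>z. cmod (f z) powr q)"
  obtains s B where "uniform_limit UNIV (\<lambda>n. convolve f (reg_kernel (\<delta> n))) s sequentially"
    "\<And>n z. cmod (convolve f (reg_kernel (\<delta> n)) z) \<le> B"
proof -
  define p where "p = q / (q - 1)"
  define \<rho> where "\<rho> n = \<delta> n powr ((2 - p) / (2 * p) * q) * (\<integral>z. cmod (f z) powr q \<partial>lborel)
        + \<delta> n powr ((2 - p) / 2) * (\<integral>z. kernel_defect 1 z powr p \<partial>lborel)" for n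
  have p: "1 < p" "p < 2" using q by (auto simp: field_simps p_def)
  have \<delta>: "\<delta> n > 0" "\<delta> n \<le> 1" for n by (auto simp: \<delta>_def field_simps)
  have \<delta>0: "\<delta> \<longlonglongrightarrow> 0" unfolding \<delta>_def by (rule LIMSEQ_inverse_real_of_nat)
  have [measurable]: "f \<in> borel_measurable borel" using f by simp
  let ?S = "\<lambda>n. convolve f (reg_kernel (\<delta> n))"
  have diff: "cmod (?S m z - ?S n z) \<le> \<rho> m + \<rho> n" for m n z
  proof -
    note I = integral_kernel_defect_bound[OF q p_def \<delta>(1) _ fq]
    have "?S m z - ?S n z
       = (\<integral>\<zeta>. f \<zeta> * reg_kernel (\<delta> m) (z - \<zeta>) - f \<zeta> * reg_kernel (\<delta> n) (z - \<zeta>) \<partial>lborel)"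
      unfolding convolve_def
      by (rule Bochner_Integration.integral_diff[symmetric])
        (auto intro!: integrable_convolve[OF f _ reg_kernel_bound] \<delta>)
    also have "cmod \<dots> \<le> (\<integral>\<zeta>. cmod (f \<zeta>) * kernel_defect (\<delta> m) (z - \<zeta>)
        + cmod (f \<zeta>) * kernel_defect (\<delta> n) (z - \<zeta>) \<partial>lborel)"
    proof (rule Bochner_Integration.integral_norm_bound_integral)
      show "cmod (f \<zeta> * reg_kernel (\<delta> m) (z - \<zeta>) - f \<zeta> * reg_kernel (\<delta> n) (z - \<zeta>))
        \<le> cmod (f \<zeta>) * kernel_defect (\<delta> m) (z - \<zeta>) + cmod (f \<zeta>) * kernel_defect (\<delta> n) (z - \<zeta>)" for \<zeta>
        unfolding right_diff_distrib[symmetric] distrib_left[symmetric] norm_mult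
        by (intro mult_left_mono reg_kernel_diff_le_defects \<delta>) simp
      show "integrable lborel (\<lambda>\<zeta>. f \<zeta> * reg_kernel (\<delta> m) (z - \<zeta>) - f \<zeta> * reg_kernel (\<delta> n) (z - \<zeta>))"
        by (intro Bochner_Integration.integrable_diff integrable_convolve[OF f _ reg_kernel_bound] \<delta>) auto
    qed (use I(1) in simp)
    also have "\<dots> = (\<integral>\<zeta>. cmod (f \<zeta>) * kernel_defect (\<delta> m) (z - \<zeta>) \<partial>lborel)
        + (\<integral>\<zeta>. cmod (f \<zeta>) * kernel_defect (\<delta> n) (z - \<zeta>) \<partial>lborel)"
      using I(1) by (intro Bochner_Integration.integral_add) auto
    also have "\<dots> \<le> \<rho> m + \<rho> n"
      unfolding \<rho>_def by (intro add_mono I(2)) auto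
    finally show ?thesis .
  qed
  have "\<rho> \<longlonglongrightarrow> 0 * (\<integral>z. cmod (f z) powr q \<partial>lborel) + 0 * (\<integral>z. kernel_defect 1 z powr p \<partial>lborel)"
    unfolding \<rho>_def[abs_def] using p q \<delta>(1)
    by (intro tendsto_intros tendsto_zero_powrI[OF \<delta>0 tendsto_const])
      (auto intro!: always_eventually simp: less_imp_le)
  then have \<rho>0: "\<rho> \<longlonglongrightarrow> 0" by simp
  have "uniformly_Cauchy_on UNIV ?S"
  proof (rule uniformly_Cauchy_onI)
    fix e :: real assume "e > 0"
    then have "\<forall>\<^sub>F n in sequentially. \<rho> n < e / 2"
      using order_tendstoD(2)[OF \<rho>0, of "e / 2"] by simp
    then obtain N where N: "\<And>n. n \<ge> N \<Longrightarrow> \<rho> n < e / 2"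
      unfolding eventually_sequentially by auto
    have "dist (?S m z) (?S n z) < e" if "m \<ge> N" "n \<ge> N" for m n z
      using diff[of m z n] N[of m] N[of n] that by (simp add: dist_norm)
    then show "\<exists>M. \<forall>x\<in>UNIV. \<forall>m\<ge>M. \<forall>n\<ge>M. dist (?S m x) (?S n x) < e" by blast
  qed
  then obtain s where s: "uniform_limit UNIV ?S s sequentially"
    using Cauchy_uniformly_convergent uniformly_convergent_on_def by blast
  obtain C where C: "\<And>n. \<bar>\<rho> n\<bar> \<le> C"
    using convergent_imp_Bseq[OF convergentI[OF \<rho>0]] by (auto simp: Bseq_def)
  \<comment> \<open>Every member lies within 2C of the one with index 0, whose kernel is bounded by
    \<open>1 / \<delta> 0\<close>.\<close>
  have "cmod (?S n z) \<le> 2 * C + 1 / \<delta> 0 * (\<integral>\<zeta>. cmod (f \<zeta>) \<partial>lborel)" for n z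
  proof -
    have "cmod (?S 0 z) \<le> 1 / \<delta> 0 * (\<integral>\<zeta>. cmod (f \<zeta>) \<partial>lborel)"
      by (intro convolve_bound f reg_kernel_bound \<delta>) simp
    then show ?thesis
      using diff[of n z 0] C[of n] C[of 0] norm_triangle_ineq2[of "?S n z" "?S 0 z"] by linarith
  qed
  with s show ?thesis by (rule that)
qed

section \<open>Fubini for convolutions and the limit of the approximate identity\<close>

lemma integrable_product:
  fixes f g :: "complex \<Rightarrow> complex"
  assumes f: "integrable lborel f" and g: "integrable lborel g"
  shows "integrable (lborel \<Otimes>\<^sub>M lborel) (\<lambda>(x, y). f x * g y)"
proof (rule lborel_pair.Fubini_integrable)
  have [measurable]: "f \<in> borel_measurable borel" "g \<in> borel_measurable borel"
    using f g by simp_all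
  show "(\<lambda>(x, y). f x * g y) \<in> borel_measurable (lborel \<Otimes>\<^sub>M lborel)" by measurable
  show "integrable lborel (\<lambda>x. \<integral>y. norm (case (x, y) of (x, y) \<Rightarrow> f x * g y) \<partial>lborel)"
    using f by (simp add: norm_mult)
  show "AE x in lborel. integrable lborel (\<lambda>y. case (x, y) of (x, y) \<Rightarrow> f x * g y)"
    using g by simp
qed

text \<open>Fubini applies because the bounded kernel leaves a multiple of |G(z) f(\<zeta>)| as
  majorant. It shifts the averaging from the merely integrable \<open>f\<close> to the factor
  \<open>G\<close>.\<close>

lemma integral_mult_convolve:
  fixes f G K :: "complex \<Rightarrow> complex"
  assumes f: "integrable lborel f" and G: "integrable lborel G"
    and K[measurable]: "K \<in> borel_measurable borel" and bound: "\<And>z. cmod (K z) \<le> B"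
  shows "(\<integral>z. G z * convolve f K z \<partial>lborel) = (\<integral>\<zeta>. f \<zeta> * (\<integral>z. G z * K (z - \<zeta>) \<partial>lborel) \<partial>lborel)"
proof -
  have [measurable]: "f \<in> borel_measurable borel" "G \<in> borel_measurable borel"
    using f G by simp_all
  have "(\<integral>z. G z * convolve f K z \<partial>lborel) = (\<integral>z. (\<integral>\<zeta>. G z * f \<zeta> * K (z - \<zeta>) \<partial>lborel) \<partial>lborel)"
    by (simp add: convolve_def mult.assoc)
  also have "\<dots> = (\<integral>\<zeta>. (\<integral>z. G z * f \<zeta> * K (z - \<zeta>) \<partial>lborel) \<partial>lborel)"
  proof (rule lborel_pair.Fubini_integral[symmetric], rule Bochner_Integration.integrable_bound)
    show "integrable (lborel \<Otimes>\<^sub>M lborel) (\<lambda>p. B * norm (case p of (x, y) \<Rightarrow> G x * f y))"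
      using integrable_product[OF G f] by simp
    show "(\<lambda>(z, \<zeta>). G z * f \<zeta> * K (z - \<zeta>)) \<in> borel_measurable (lborel \<Otimes>\<^sub>M lborel)"
      by measurable
    have "norm (G z * f \<zeta> * K (z - \<zeta>)) \<le> B * norm (G z * f \<zeta>)" for z \<zeta>
      using mult_left_mono[OF bound[of "z - \<zeta>"] norm_ge_zero[of "G z * f \<zeta>"]]
      by (simp add: norm_mult mult_ac)
    then show "AE p in lborel \<Otimes>\<^sub>M lborel. norm (case p of (z, \<zeta>) \<Rightarrow> G z * f \<zeta> * K (z - \<zeta>))
        \<le> norm (B * norm (case p of (x, y) \<Rightarrow> G x * f y))"
      by (intro AE_I2) (auto intro: order_trans[OF _ abs_ge_self])
  qed
  also have "\<dots> = (\<integral>\<zeta>. f \<zeta> * (\<integral>z. G z * K (z - \<zeta>) \<partial>lborel) \<partial>lborel)"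
  proof (rule Bochner_Integration.integral_cong[OF refl])
    fix \<zeta>
    have "(\<integral>z. G z * f \<zeta> * K (z - \<zeta>) \<partial>lborel) = (\<integral>z. f \<zeta> * (G z * K (z - \<zeta>)) \<partial>lborel)"
      by (simp only: mult_ac)
    then show "(\<integral>z. G z * f \<zeta> * K (z - \<zeta>) \<partial>lborel) = f \<zeta> * (\<integral>z. G z * K (z - \<zeta>) \<partial>lborel)"
      by (simp only: integral_mult_right_zero)
  qed
  finally show ?thesis .
qed

text \<open>After Fubini the approximate identity averages \<open>G n\<close>, whose uniform limit
  is continuous, so the averages converge pointwise and no convergence of mollified \<open>f\<close>
  is involved.\<close>

lemma integral_mult_convolve_approx_identity_tendsto:
  fixes f :: "complex \<Rightarrow> complex" and G :: "nat \<Rightarrow> complex \<Rightarrow> complex"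
  assumes f: "integrable lborel f" and G: "\<And>n. integrable lborel (G n)"
    and B: "\<And>n z. cmod (G n z) \<le> B"
    and lim: "uniform_limit UNIV G g sequentially" and g: "continuous_on UNIV g"
    and \<delta>: "\<And>n. \<delta> n > 0" "\<delta> \<longlonglongrightarrow> 0"
  shows "(\<lambda>n. \<integral>z. G n z * convolve f (\<lambda>w. of_real (approx_identity (\<delta> n) w)) z \<partial>lborel)
    \<longlonglongrightarrow> (\<integral>z. f z * (of_real approx_mass * g z) \<partial>lborel)"
proof -
  have [measurable]: "f \<in> borel_measurable borel" "g \<in> borel_measurable borel"
    "\<And>n. G n \<in> borel_measurable borel"
    using f G g by (simp_all add: borel_measurable_continuous_onI borel_measurable_integrable[of lborel, simplified])
  \<comment> \<open>The average of \<open>G n\<close> around \<zeta> at scale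
    \<open>\<delta> n\<close>, rescaled so that the weight no longer depends on n.\<close>
  let ?J = "\<lambda>n \<zeta>. \<integral>\<eta>. G n (\<zeta> + \<delta> n *\<^sub>R \<eta>) * of_real (approx_identity 1 \<eta>) \<partial>lborel"
  have eq: "(\<integral>z. G n z * convolve f (\<lambda>w. of_real (approx_identity (\<delta> n) w)) z \<partial>lborel)
    = (\<integral>\<zeta>. f \<zeta> * ?J n \<zeta> \<partial>lborel)" for n
  proof -
    have inner: "(\<integral>z. G n z * of_real (approx_identity (\<delta> n) (z - \<zeta>)) \<partial>lborel) = ?J n \<zeta>" for \<zeta>
    proof -
      have "(\<integral>z. G n z * of_real (approx_identity (\<delta> n) (z - \<zeta>)) \<partial>lborel)
        = \<bar>\<delta> n\<bar> ^ DIM(complex) *\<^sub>R (\<integral>\<eta>. G n (\<zeta> + \<delta> n *\<^sub>R \<eta>) *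
            of_real (approx_identity (\<delta> n) (\<zeta> + \<delta> n *\<^sub>R \<eta> - \<zeta>)) \<partial>lborel)"
        using \<delta>(1)[of n] by (intro lborel_integral_affine) auto
      also have "\<dots> = (\<integral>\<eta>. (\<delta> n)\<^sup>2 *\<^sub>R (G n (\<zeta> + \<delta> n *\<^sub>R \<eta>) *
            of_real (approx_identity (\<delta> n) (\<delta> n *\<^sub>R \<eta>))) \<partial>lborel)"
        by simp
      also have "\<dots> = ?J n \<zeta>"
      proof (intro Bochner_Integration.integral_cong refl)
        fix \<eta>
        have "(\<delta> n)\<^sup>2 * approx_identity (\<delta> n) (\<delta> n *\<^sub>R \<eta>) = approx_identity 1 \<eta>"
          using \<delta>(1)[of n] by (simp only: approx_identity_scale[OF \<delta>(1)]) simp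
        then show "(\<delta> n)\<^sup>2 *\<^sub>R (G n (\<zeta> + \<delta> n *\<^sub>R \<eta>) * of_real (approx_identity (\<delta> n) (\<delta> n *\<^sub>R \<eta>)))
          = G n (\<zeta> + \<delta> n *\<^sub>R \<eta>) * of_real (approx_identity 1 \<eta>)"
          unfolding mult_scaleR_right[symmetric] scaleR_conv_of_real[of _ "of_real _"] of_real_mult[symmetric]
          by (simp only:)
      qed
      finally show ?thesis .
    qed
    have "(\<integral>z. G n z * convolve f (\<lambda>w. of_real (approx_identity (\<delta> n) w)) z \<partial>lborel)
      = (\<integral>\<zeta>. f \<zeta> * (\<integral>z. G n z * of_real (approx_identity (\<delta> n) (z - \<zeta>)) \<partial>lborel) \<partial>lborel)"
      using approx_identity_bound[OF \<delta>(1)]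
      by (intro integral_mult_convolve[OF f G]) auto
    then show ?thesis by (simp only: inner)
  qed
  have Jlim: "(\<lambda>n. ?J n \<zeta>) \<longlonglongrightarrow> of_real approx_mass * g \<zeta>" for \<zeta>
  proof -
    have "(\<lambda>n. ?J n \<zeta>) \<longlonglongrightarrow> (\<integral>\<eta>. g \<zeta> * of_real (approx_identity 1 \<eta>) \<partial>lborel)"
    proof (rule integral_dominated_convergence)
      show "integrable lborel (\<lambda>\<eta>. B * approx_identity 1 \<eta>)"
        using integrable_approx_identity_1 by simp
      show "AE \<eta> in lborel. (\<lambda>n. G n (\<zeta> + \<delta> n *\<^sub>R \<eta>) * of_real (approx_identity 1 \<eta>))
          \<longlonglongrightarrow> g \<zeta> * of_real (approx_identity 1 \<eta>)"
      proof (intro AE_I2 tendsto_mult tendsto_const)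
        fix \<eta>
        have "(\<lambda>n. \<zeta> + \<delta> n *\<^sub>R \<eta>) \<longlonglongrightarrow> \<zeta> + 0 *\<^sub>R \<eta>"
          by (intro tendsto_intros \<delta>)
        then have "(\<lambda>n. g (\<zeta> + \<delta> n *\<^sub>R \<eta>)) \<longlonglongrightarrow> g \<zeta>"
          by (intro continuous_on_tendsto_compose[OF g]) auto
        \<comment> \<open>The evaluation point moves with n, which is why uniform convergence of
          \<open>G\<close> is required here.\<close>
        moreover have "(\<lambda>n. G n (\<zeta> + \<delta> n *\<^sub>R \<eta>) - g (\<zeta> + \<delta> n *\<^sub>R \<eta>)) \<longlonglongrightarrow> 0"
        proof (rule LIMSEQ_I)
          fix e :: real assume "e > 0"
          with lim show "\<exists>N. \<forall>n\<ge>N. norm (G n (\<zeta> + \<delta> n *\<^sub>R \<eta>) - g (\<zeta> + \<delta> n *\<^sub>R \<eta>) - 0) < e"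
            unfolding uniform_limit_sequentially_iff dist_norm by fastforce
        qed
        ultimately have "(\<lambda>n. (G n (\<zeta> + \<delta> n *\<^sub>R \<eta>) - g (\<zeta> + \<delta> n *\<^sub>R \<eta>)) + g (\<zeta> + \<delta> n *\<^sub>R \<eta>)) \<longlonglongrightarrow> 0 + g \<zeta>"
          by (intro tendsto_add)
        then show "(\<lambda>n. G n (\<zeta> + \<delta> n *\<^sub>R \<eta>)) \<longlonglongrightarrow> g \<zeta>" by simp
      qed
      show "AE \<eta> in lborel. norm (G n (\<zeta> + \<delta> n *\<^sub>R \<eta>) * of_real (approx_identity 1 \<eta>)) \<le> B * approx_identity 1 \<eta>" for n
        using B by (intro AE_I2) (simp add: norm_mult mult_right_mono)
    qed simp_all
    also have "(\<integral>\<eta>. g \<zeta> * of_real (approx_identity 1 \<eta>) \<partial>lborel) = of_real approx_mass * g \<zeta>"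
      by (simp add: approx_mass_def)
    finally show ?thesis .
  qed
  have Jmeas [measurable]: "?J n \<in> borel_measurable borel" for n
    by measurable
  have Jbound: "cmod (?J n \<zeta>) \<le> B * approx_mass" for n \<zeta>
  proof -
    have "cmod (?J n \<zeta>) \<le> (\<integral>\<eta>. B * approx_identity 1 \<eta> \<partial>lborel)"
    proof (rule Bochner_Integration.integral_norm_bound_integral)
      show le: "norm (G n (\<zeta> + \<delta> n *\<^sub>R \<eta>) * of_real (approx_identity 1 \<eta>)) \<le> B * approx_identity 1 \<eta>" for \<eta>
        using B by (simp add: norm_mult mult_right_mono)
      show "integrable lborel (\<lambda>\<eta>. B * approx_identity 1 \<eta>)"
        using integrable_approx_identity_1 by simp
      then show "integrable lborel (\<lambda>\<eta>. G n (\<zeta> + \<delta> n *\<^sub>R \<eta>) * of_real (approx_identity 1 \<eta>))"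
        by (rule Bochner_Integration.integrable_bound) (auto intro!: AE_I2 order_trans[OF le])
    qed
    then show ?thesis by (simp add: approx_mass_def)
  qed
  have "(\<lambda>n. \<integral>\<zeta>. f \<zeta> * ?J n \<zeta> \<partial>lborel) \<longlonglongrightarrow> (\<integral>z. f z * (of_real approx_mass * g z) \<partial>lborel)"
  proof (rule integral_dominated_convergence)
    show "integrable lborel (\<lambda>\<zeta>. B * approx_mass * cmod (f \<zeta>))" using f by simp
    show "AE \<zeta> in lborel. (\<lambda>n. f \<zeta> * ?J n \<zeta>) \<longlonglongrightarrow> f \<zeta> * (of_real approx_mass * g \<zeta>)"
      by (intro AE_I2 tendsto_mult tendsto_const Jlim)
    show "AE \<zeta> in lborel. cmod (f \<zeta> * ?J n \<zeta>) \<le> B * approx_mass * cmod (f \<zeta>)" for n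
      unfolding norm_mult[of "f _"]
      by (subst (2) mult.commute) (intro AE_I2 mult_left_mono Jbound norm_ge_zero)
  qed simp_all
  then show ?thesis by (simp only: eq)
qed

text \<open>The second conclusion is the weak form of dbar e^s = f e^s. It admits all C^1 functions
  of compact support with explicit partials \<open>\<psi>1\<close> and \<open>\<psi>i\<close>, so
  that products of a test function with a C^1 factor can be inserted later.\<close>

theorem exp_solves_dbar_equation:
  fixes f :: "complex \<Rightarrow> complex"
  assumes q: "q > 2" and f: "integrable lborel f" and fq: "integrable lborel (\<lambda>z. cmod (f z) powr q)"
  obtains s where "continuous_on UNIV s"
    "\<And>\<psi> \<psi>1 \<psi>i R. \<lbrakk>continuous_on UNIV \<psi>; continuous_on UNIV \<psi>1; continuous_on UNIV \<psi>i;
       \<And>z. cmod z > R \<Longrightarrow> \<psi> z = 0 \<and> \<psi>1 z = 0 \<and> \<psi>i z = 0;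
       \<And>z. dir_deriv 1 \<psi> (\<psi>1 z) z; \<And>z. dir_deriv \<i> \<psi> (\<psi>i z) z\<rbrakk> \<Longrightarrow>
       (\<integral>z. (\<psi>1 z + \<i> * \<psi>i z) / 2 * exp (s z) \<partial>lborel) = - (\<integral>z. \<psi> z * (f z * exp (s z)) \<partial>lborel)"
proof -
  define \<delta> where "\<delta> n = inverse (real (Suc n))" for n
  have \<delta>: "\<delta> n > 0" for n by (simp add: \<delta>_def)
  have \<delta>0: "\<delta> \<longlonglongrightarrow> 0" unfolding \<delta>_def by (rule LIMSEQ_inverse_real_of_nat)
  \<comment> \<open>The dbar-derivatives of the convolutions tend weakly to
    \<open>approx_mass\<close> times the datum; the division compensates for this.\<close>
  define g where "g z = f z / of_real approx_mass" for z
  have g: "integrable lborel g" using f by (simp add: g_def[abs_def])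
  have "cmod (g z) powr q = cmod (f z) powr q / approx_mass powr q" for z
    using approx_mass_pos by (simp add: g_def norm_divide powr_divide)
  then have gq: "integrable lborel (\<lambda>z. cmod (g z) powr q)" using fq by simp
  define S where "S n = convolve g (reg_kernel (\<delta> n))" for n
  obtain s B where s: "uniform_limit UNIV S s sequentially" and B: "\<And>n z. cmod (S n z) \<le> B"
    using uniform_limit_convolve_reg_kernel[OF q g gq] unfolding S_def \<delta>_def by metis
  have S_cont: "continuous_on UNIV (S n)" for n
    unfolding S_def
    by (intro continuous_on_convolve[OF g continuous_on_reg_kernel reg_kernel_bound] \<delta>)
  have s_cont: "continuous_on UNIV s"
    by (rule uniform_limit_theorem[OF _ s]) (auto simp: S_cont)
  have S_lim: "(\<lambda>n. S n z) \<longlonglongrightarrow> s z" for z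
    using s by (rule tendsto_uniform_limitI) simp
  have expB: "cmod (exp (S n z)) \<le> exp B" for n z
    using B[of n z] norm_exp[of "S n z"] by (meson exp_le_cancel_iff order_trans)
  show thesis
  proof (rule that[OF s_cont])
    fix \<psi> \<psi>1 \<psi>i :: "complex \<Rightarrow> complex" and R :: real
    assume cont [continuous_intros]: "continuous_on UNIV \<psi>" "continuous_on UNIV \<psi>1" "continuous_on UNIV \<psi>i"
      and supp: "\<And>z. cmod z > R \<Longrightarrow> \<psi> z = 0 \<and> \<psi>1 z = 0 \<and> \<psi>i z = 0"
      and D1: "\<And>z. dir_deriv 1 \<psi> (\<psi>1 z) z" and Di: "\<And>z. dir_deriv \<i> \<psi> (\<psi>i z) z"
    define S' where "S' d n = convolve g (reg_kernel_deriv (\<delta> n) d)" for d n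
    have S'_cont: "continuous_on UNIV (S' d n)" for d n
      unfolding S'_def
      by (intro continuous_on_convolve[OF g continuous_on_reg_kernel_deriv reg_kernel_deriv_bound] \<delta>)
    note [continuous_intros] = continuous_on_exp[OF S_cont] S'_cont
    have S'_deriv: "dir_deriv d (S n) (S' d n z) z" for d n z
      unfolding S_def S'_def using \<delta>
      by (intro dir_deriv_convolve[OF g continuous_on_reg_kernel reg_kernel_bound reg_kernel_lipschitz dir_deriv_reg_kernel])
    \<comment> \<open>Integration by parts: the integrand is the directional derivative of \<psi>
      exp(S n), which has compact support.\<close>
    have part: "integrable lborel (\<lambda>z. \<psi> z * (S' d n z * exp (S n z)) + \<psi>' z * exp (S n z))"
        "(\<integral>z. \<psi> z * (S' d n z * exp (S n z)) + \<psi>' z * exp (S n z) \<partial>lborel) = 0"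
      if \<psi>': "continuous_on UNIV \<psi>'" "\<And>z. cmod z > R \<Longrightarrow> \<psi>' z = 0" "\<And>z. dir_deriv d \<psi> (\<psi>' z) z" for d \<psi>' n
    proof -
      let ?F' = "\<lambda>z. \<psi> z * (S' d n z * exp (S n z)) + \<psi>' z * exp (S n z)"
      have F': "continuous_on UNIV ?F'" "\<And>z. cmod z > R \<Longrightarrow> ?F' z = 0"
        using \<psi>' supp by (auto intro!: continuous_intros)
      show "integrable lborel ?F'" using F' by (rule integrable_compact_support)
      obtain C where C: "\<And>z. cmod (?F' z) \<le> C" using bounded_compact_support[OF F'] by blast
      have "integrable lborel (\<lambda>z. \<psi> z * exp (S n z))"
        by (rule integrable_compact_support[of _ R]) (auto intro!: continuous_intros simp: supp)
      moreover have "dir_deriv d (\<lambda>z. \<psi> z * exp (S n z)) (?F' z) z" for z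
        by (intro dir_deriv_mult dir_deriv_exp \<psi>' S'_deriv)
      ultimately show "(\<integral>z. ?F' z \<partial>lborel) = 0"
        using C supp by (intro integral_dir_deriv_eq_0[of d "\<lambda>z. \<psi> z * exp (S n z)" ?F' C R]) auto
    qed
    have dbar_S: "(S' 1 n z + \<i> * S' \<i> n z) / 2 = convolve g (\<lambda>w. of_real (approx_identity (\<delta> n) w)) z" for n z
    proof -
      have I: "integrable lborel (\<lambda>\<zeta>. g \<zeta> * reg_kernel_deriv (\<delta> n) d (z - \<zeta>))" for d
        by (intro integrable_convolve[OF g _ reg_kernel_deriv_bound] \<delta>
            borel_measurable_continuous_onI continuous_on_reg_kernel_deriv)
      have "(S' 1 n z + \<i> * S' \<i> n z) / 2 = (\<integral>\<zeta>. (g \<zeta> * reg_kernel_deriv (\<delta> n) 1 (z - \<zeta>)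
          + \<i> * (g \<zeta> * reg_kernel_deriv (\<delta> n) \<i> (z - \<zeta>))) / 2 \<partial>lborel)"
        using I by (simp add: S'_def convolve_def)
      also have "\<dots> = convolve g (\<lambda>w. of_real (approx_identity (\<delta> n) w)) z"
        unfolding convolve_def dbar_reg_kernel[OF \<delta>, symmetric]
        by (intro Bochner_Integration.integral_cong refl) (simp add: algebra_simps)
      finally show ?thesis .
    qed
    let ?a = "\<lambda>n. convolve g (\<lambda>w. of_real (approx_identity (\<delta> n) w))"
    let ?\<Psi> = "\<lambda>z. (\<psi>1 z + \<i> * \<psi>i z) / 2"
    have \<Psi>: "continuous_on UNIV ?\<Psi>" "\<And>z. cmod z > R \<Longrightarrow> ?\<Psi> z = 0"
      using supp by (auto intro!: continuous_intros)
    have a_cont: "continuous_on UNIV (?a n)" for n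
      unfolding dbar_S[symmetric] by (intro continuous_intros) auto
    \<comment> \<open>The identities for directions 1 and \<i> are added with weights 1/2 and
      \<i>/2, which assembles dbar on both factors.\<close>
    have sum: "(\<integral>z. ?\<Psi> z * exp (S n z) \<partial>lborel) = - (\<integral>z. \<psi> z * exp (S n z) * ?a n z \<partial>lborel)" for n
    proof -
      note p1 = part[OF cont(2) _ D1, of n] and pi = part[OF cont(3) _ Di, of n]
      have "0 = (\<integral>z. ((\<psi> z * (S' 1 n z * exp (S n z)) + \<psi>1 z * exp (S n z))
          + \<i> * (\<psi> z * (S' \<i> n z * exp (S n z)) + \<psi>i z * exp (S n z))) / 2 \<partial>lborel)"
        using p1 pi supp by simp
      also have "\<dots> = (\<integral>z. ?\<Psi> z * exp (S n z) + \<psi> z * exp (S n z) * ?a n z \<partial>lborel)"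
        unfolding dbar_S[symmetric]
        by (intro Bochner_Integration.integral_cong refl) (simp add: field_simps)
      also have "\<dots> = (\<integral>z. ?\<Psi> z * exp (S n z) \<partial>lborel) + (\<integral>z. \<psi> z * exp (S n z) * ?a n z \<partial>lborel)"
        by (intro Bochner_Integration.integral_add integrable_compact_support[of _ R])
          (use supp \<Psi> a_cont in \<open>auto intro!: continuous_intros\<close>)
      finally show ?thesis by (simp add: eq_neg_iff_add_eq_0)
    qed
    obtain C where C: "C \<ge> 0" "\<And>z. cmod (\<psi> z) \<le> C"
      using bounded_compact_support[OF cont(1)] supp by metis
    \<comment> \<open>\<open>exp\<close> is not uniformly continuous on the plane; the common bound
      \<open>B\<close> confines all values of \<open>S n\<close> to a compact ball.\<close>
    have exp_lim: "uniform_limit UNIV (\<lambda>n z. exp (S n z)) (\<lambda>z. exp (s z)) sequentially"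
    proof (rule uniform_limit_compose_uniformly_continuous_on[OF s])
      show "uniformly_continuous_on (cball 0 B) (exp :: complex \<Rightarrow> complex)"
        by (intro compact_uniformly_continuous continuous_intros) auto
    qed (use B in auto)
    have "(\<lambda>n. \<integral>z. \<psi> z * exp (S n z) * ?a n z \<partial>lborel)
        \<longlonglongrightarrow> (\<integral>z. g z * (of_real approx_mass * (\<psi> z * exp (s z))) \<partial>lborel)"
    proof (rule integral_mult_convolve_approx_identity_tendsto[OF g _ _ _ _ \<delta> \<delta>0])
      show "integrable lborel (\<lambda>z. \<psi> z * exp (S n z))" for n
        by (rule integrable_compact_support[of _ R]) (auto intro!: continuous_intros simp: supp)
      show "cmod (\<psi> z * exp (S n z)) \<le> C * exp B" for n z
        unfolding norm_mult using C expB by (intro mult_mono) auto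
      show "uniform_limit UNIV (\<lambda>n z. \<psi> z * exp (S n z)) (\<lambda>z. \<psi> z * exp (s z)) sequentially"
        unfolding uniform_limit_sequentially_iff dist_norm
      proof (intro allI impI)
        fix e :: real assume "e > 0"
        \<comment> \<open>The summand 1 covers the case C = 0.\<close>
        then have "e / (C + 1) > 0" using C by simp
        then obtain N where N: "\<And>n z. n \<ge> N \<Longrightarrow> norm (exp (S n z) - exp (s z)) < e / (C + 1)"
          using exp_lim unfolding uniform_limit_sequentially_iff dist_norm by blast
        have "norm (\<psi> z * exp (S n z) - \<psi> z * exp (s z)) < e" if "n \<ge> N" for n z
        proof -
          have "norm (\<psi> z * exp (S n z) - \<psi> z * exp (s z)) \<le> C * (e / (C + 1))"
            unfolding right_diff_distrib[symmetric] norm_mult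
            using C N[OF that, of z] by (intro mult_mono) auto
          also have "\<dots> < e" using C \<open>e > 0\<close> by (simp add: field_simps)
          finally show ?thesis .
        qed
        then show "\<exists>N. \<forall>n\<ge>N. \<forall>z\<in>UNIV. norm (\<psi> z * exp (S n z) - \<psi> z * exp (s z)) < e" by blast
      qed
      show "continuous_on UNIV (\<lambda>z. \<psi> z * exp (s z))"
        by (intro continuous_intros s_cont)
    qed
    also have "(\<integral>z. g z * (of_real approx_mass * (\<psi> z * exp (s z))) \<partial>lborel) = (\<integral>z. \<psi> z * (f z * exp (s z)) \<partial>lborel)"
      using approx_mass_pos by (intro Bochner_Integration.integral_cong refl) (simp add: g_def)
    finally have "(\<lambda>n. - (\<integral>z. \<psi> z * exp (S n z) * ?a n z \<partial>lborel)) \<longlonglongrightarrow> - (\<integral>z. \<psi> z * (f z * exp (s z)) \<partial>lborel)"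
      by (rule tendsto_minus)
    moreover have "(\<lambda>n. \<integral>z. ?\<Psi> z * exp (S n z) \<partial>lborel) \<longlonglongrightarrow> (\<integral>z. ?\<Psi> z * exp (s z) \<partial>lborel)"
    proof (rule integral_dominated_convergence)
      have [measurable]: "?\<Psi> \<in> borel_measurable borel" "s \<in> borel_measurable borel" "\<And>n. S n \<in> borel_measurable borel"
        by (intro borel_measurable_continuous_onI \<Psi> s_cont S_cont)+
      show "(\<lambda>z. ?\<Psi> z * exp (s z)) \<in> borel_measurable lborel" by measurable
      show "(\<lambda>z. ?\<Psi> z * exp (S n z)) \<in> borel_measurable lborel" for n by measurable
      show "integrable lborel (\<lambda>z. exp B * cmod (?\<Psi> z))"
        using integrable_compact_support[OF \<Psi>] by (intro integrable_mult_right integrable_norm)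
      show "AE z in lborel. (\<lambda>n. ?\<Psi> z * exp (S n z)) \<longlonglongrightarrow> ?\<Psi> z * exp (s z)"
        by (intro AE_I2 tendsto_mult tendsto_const tendsto_exp S_lim)
      show "AE z in lborel. norm (?\<Psi> z * exp (S n z)) \<le> exp B * cmod (?\<Psi> z)" for n
      proof (rule AE_I2)
        fix z
        show "norm (?\<Psi> z * exp (S n z)) \<le> exp B * cmod (?\<Psi> z)"
          using mult_left_mono[OF expB[of n z] norm_ge_zero[of "?\<Psi> z"]]
          by (simp only: norm_mult mult.commute)
      qed
    qed
    ultimately show "(\<integral>z. ?\<Psi> z * exp (s z) \<partial>lborel) = - (\<integral>z. \<psi> z * (f z * exp (s z)) \<partial>lborel)"
      unfolding sum by (rule LIMSEQ_unique[THEN sym])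
  qed
qed

section \<open>The bicomplex equation\<close>

text \<open>This is c times the idempotent (1 - ij)/2: its plus component is 0 and its minus
  component is c.\<close>

definition minus_embed :: "complex \<Rightarrow> bicomplex" where
  "minus_embed c = Bicomplex (c / 2) (- \<i> * c / 2)"

text \<open>Multiples of the idempotent form an ideal on which a bicomplex number acts through its
  minus component; in particular \<open>bc_j\<close> acts as \<i>.\<close>

lemma mult_minus_embed: "A * minus_embed c = minus_embed (bc_minus A * c)"
  by (rule bicomplex_eqI) (simp_all add: minus_embed_def bc_minus_def field_simps)

lemma norm_minus_embed: "norm (minus_embed c) = cmod c / sqrt 2"
proof -
  have "bc_plus (minus_embed c) = 0" "bc_minus (minus_embed c) = c"
    by (simp_all add: bc_plus_def bc_minus_def minus_embed_def field_simps)
  then show ?thesis by (simp add: norm_bicomplex_def real_sqrt_divide)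
qed

lemma bounded_linear_minus_embed: "bounded_linear minus_embed"
proof (rule bounded_linear_intro)
  show "norm (minus_embed c) \<le> norm c * (1 / sqrt 2)" for c
    by (simp add: norm_minus_embed)
  show "minus_embed (c + d) = minus_embed c + minus_embed d" for c d
    by (rule bicomplex_eqI) (simp_all add: minus_embed_def field_simps)
  show "minus_embed (r *\<^sub>R c) = r *\<^sub>R minus_embed c" for r c
    by (rule bicomplex_eqI) (simp_all add: minus_embed_def)
qed

lemmas minus_embed_zero = linear_0[OF bounded_linear.linear[OF bounded_linear_minus_embed]]
  and minus_embed_minus = linear_neg[OF bounded_linear.linear[OF bounded_linear_minus_embed]]
  and minus_embed_diff = linear_diff[OF bounded_linear.linear[OF bounded_linear_minus_embed]]
  and minus_embed_scaleR = linear_scale[OF bounded_linear.linear[OF bounded_linear_minus_embed]]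

lemma norm_bc_minus_le: "cmod (bc_minus w) \<le> sqrt 2 * norm w"
proof -
  have "(cmod (bc_minus w))\<^sup>2 \<le> (cmod (bc_plus w))\<^sup>2 + (cmod (bc_minus w))\<^sup>2" by simp
  then have "sqrt ((cmod (bc_minus w))\<^sup>2) \<le> sqrt (2 * (((cmod (bc_plus w))\<^sup>2 + (cmod (bc_minus w))\<^sup>2) / 2))"
    by (intro real_sqrt_le_mono) simp
  then show ?thesis by (simp only: real_sqrt_mult norm_bicomplex_def real_sqrt_abs abs_norm_cancel)
qed

lemma bounded_linear_bc_minus: "bounded_linear bc_minus"
proof (rule bounded_linear_intro)
  show "norm (bc_minus w) \<le> norm w * sqrt 2" for w
    using norm_bc_minus_le[of w] by (simp add: mult.commute)
  show "bc_minus (v + w) = bc_minus v + bc_minus w" for v w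
    by (simp add: bc_minus_def algebra_simps)
  show "bc_minus (r *\<^sub>R w) = r *\<^sub>R bc_minus w" for r w
    by (simp add: bc_minus_def scaleR_right_distrib)
qed

text \<open>Passes from a Lebesgue measurable coefficient on the disk to a Borel function on the
  plane, extended by 0, as the convolutions require. Integrability follows from the finite area of
  the disk and x \<le> 1 + x^q.\<close>

lemma L_space_borel_representative:
  assumes A: "A \<in> L_space q" and q: "q > 1"
  obtains f where "integrable lborel f" "integrable lborel (\<lambda>z. cmod (f z) powr q)"
    "\<And>z. z \<notin> unit_disk \<Longrightarrow> f z = 0" "AE z in lebesgue_on unit_disk. bc_minus (A z) = f z"
proof -
  have [measurable]: "bc_minus \<in> borel_measurable borel"
    by (intro borel_measurable_continuous_onI linear_continuous_on bounded_linear_bc_minus)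
  have Am [measurable]: "A \<in> borel_measurable (lebesgue_on unit_disk)"
    and Aq: "integrable (lebesgue_on unit_disk) (\<lambda>z. norm (A z) powr q)"
    using A by (auto simp: L_space_def)
  define g where "g z = (if z \<in> unit_disk then bc_minus (A z) else 0)" for z
  have "(\<lambda>z. bc_minus (A z)) \<in> borel_measurable (lebesgue_on unit_disk)" by measurable
  then have gm [measurable]: "g \<in> borel_measurable lebesgue"
    unfolding g_def[abs_def] by (rule borel_measurable_if_I) auto
  obtain a b where "a \<in> borel_measurable lborel" "b \<in> borel_measurable lborel"
    and ab: "AE z in lborel. Re (g z) = a z" "AE z in lborel. Im (g z) = b z"
    using completion_ex_borel_measurable_real[of "\<lambda>z. Re (g z)" lborel]
      completion_ex_borel_measurable_real[of "\<lambda>z. Im (g z)" lborel] by auto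
  then have [measurable]: "a \<in> borel_measurable borel" "b \<in> borel_measurable borel"
      "unit_disk \<in> sets borel" by simp_all
  define f where "f z = indicator unit_disk z *\<^sub>R (of_real (a z) + \<i> * of_real (b z))" for z :: complex
  have fm [measurable]: "f \<in> borel_measurable borel" unfolding f_def[abs_def] by measurable
  have fg: "AE z in lborel. g z = f z"
    using ab by eventually_elim (auto simp: f_def g_def complex_eq_iff indicator_def)
  then have fg': "AE z in lebesgue. g z = f z" by (rule AE_completion)
  have "integrable (lebesgue_on unit_disk) (\<lambda>z. sqrt 2 powr q * norm (A z) powr q)"
    using Aq by simp
  then have "integrable lebesgue (\<lambda>z. indicator unit_disk z *\<^sub>R (sqrt 2 powr q * norm (A z) powr q))"
    by (subst (asm) integrable_restrict_space) auto
  then have "integrable lebesgue (\<lambda>z. cmod (g z) powr q)"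
  proof (rule Bochner_Integration.integrable_bound)
    have "cmod (bc_minus (A z)) powr q \<le> sqrt 2 powr q * norm (A z) powr q" for z
      using q norm_bc_minus_le by (auto simp flip: powr_mult intro!: powr_mono2)
    then show "AE z in lebesgue. norm (cmod (g z) powr q)
       \<le> norm (indicator unit_disk z *\<^sub>R (sqrt 2 powr q * norm (A z) powr q))"
      by (intro AE_I2) (auto simp: g_def)
  qed measurable
  then have "integrable lebesgue (\<lambda>z. cmod (f z) powr q)"
    by (subst integrable_cong_AE[of _ _ "\<lambda>z. cmod (g z) powr q"]) (use fg' in \<open>auto simp: measurable_completion\<close>)
  then have fq: "integrable lborel (\<lambda>z. cmod (f z) powr q)"
    by (simp add: integrable_completion)
  have "integrable lborel (\<lambda>z. indicator unit_disk z + cmod (f z) powr q)"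
    using fq by (intro Bochner_Integration.integrable_add integrable_real_indicator emeasure_bounded_finite) auto
  then have "integrable lborel f"
  proof (rule Bochner_Integration.integrable_bound)
    have "x \<le> 1 + x powr q" if "x \<ge> 0" for x :: real
      using that q powr_mono[of 1 q x] by (cases "x \<le> 1") (auto intro: add_increasing2)
    then show "AE z in lborel. norm (f z) \<le> norm (indicator unit_disk z + cmod (f z) powr q)"
      by (intro AE_I2) (auto simp: f_def indicator_def)
  qed simp
  moreover have "AE z in lebesgue_on unit_disk. bc_minus (A z) = f z"
    using fg' by (subst AE_restrict_space_iff) (auto simp: g_def)
  ultimately show ?thesis
    using that[of f] fq by (auto simp: f_def)
qed

section \<open>Test functions and weak derivatives of embedded functions\<close>

lemma dir_deriv_of_real:
  assumes "\<phi> differentiable (at z)"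
  shows "dir_deriv d (\<lambda>z. of_real (\<phi> z)) (of_real (frechet_derivative \<phi> (at z) d)) z"
proof -
  have "((\<lambda>t. z + of_real t * d) has_vector_derivative d) (at 0)"
    by (auto intro!: derivative_eq_intros)
  moreover have "(\<phi> has_derivative frechet_derivative \<phi> (at z)) (at (z + of_real 0 * d))"
    using assms by (simp add: frechet_derivative_works)
  ultimately have "(\<phi> \<circ> (\<lambda>t. z + of_real t * d) has_vector_derivative frechet_derivative \<phi> (at z) d) (at 0)"
    by (intro vector_derivative_diff_chain_within[of _ _ _ UNIV, simplified])
      (auto intro: has_derivative_at_withinI)
  then show ?thesis
    unfolding dir_deriv_def o_def by (rule bounded_linear.has_vector_derivative[OF bounded_linear_of_real])
qed

text \<open>The complement of the compact support set is open and contains every point outside the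
  disk, the unit circle included, so near such a point the function is zero and both partials
  vanish.\<close>

lemma test_function_properties:
  assumes "test_function \<phi>"
  obtains "continuous_on UNIV \<phi>" "continuous_on UNIV (pd_x \<phi>)" "continuous_on UNIV (pd_y \<phi>)"
    "\<And>z. dir_deriv 1 (\<lambda>z. of_real (\<phi> z)) (of_real (pd_x \<phi> z)) z"
    "\<And>z. dir_deriv \<i> (\<lambda>z. of_real (\<phi> z)) (of_real (pd_y \<phi> z)) z"
    "\<And>z. z \<notin> unit_disk \<Longrightarrow> \<phi> z = 0 \<and> pd_x \<phi> z = 0 \<and> pd_y \<phi> z = 0"
proof
  have C: "C_k 0 \<phi>" "C_k 1 \<phi>" using assms by (auto simp: test_function_def)
  then show "continuous_on UNIV \<phi>" "continuous_on UNIV (pd_x \<phi>)" "continuous_on UNIV (pd_y \<phi>)"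
    by simp_all
  have "\<phi> differentiable (at z)" for z using C by simp
  then show "dir_deriv 1 (\<lambda>z. of_real (\<phi> z)) (of_real (pd_x \<phi> z)) z"
    "dir_deriv \<i> (\<lambda>z. of_real (\<phi> z)) (of_real (pd_y \<phi> z)) z" for z
    unfolding pd_x_def pd_y_def by (rule dir_deriv_of_real)+
  obtain K where K: "compact K" "K \<subseteq> unit_disk" "\<And>z. z \<notin> K \<Longrightarrow> \<phi> z = 0"
    using assms by (auto simp: test_function_def)
  fix z :: complex assume "z \<notin> unit_disk"
  then have z: "z \<in> - K" using K by auto
  have "open (- K)" using K(1) by (simp add: compact_imp_closed open_Compl)
  then have "(\<phi> has_derivative (\<lambda>h. 0)) (at z)"
    using z K(3) by (intro has_derivative_transform_within_open[of "\<lambda>_. 0" "\<lambda>h. 0" z UNIV "- K" \<phi>, simplified]) auto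
  then have "frechet_derivative \<phi> (at z) = (\<lambda>h. 0)"
    by (rule frechet_derivative_at[symmetric])
  then show "\<phi> z = 0 \<and> pd_x \<phi> z = 0 \<and> pd_y \<phi> z = 0"
    using z K(3) by (simp add: pd_x_def pd_y_def)
qed

text \<open>Turns the bicomplex integrals in the weak equation into complex Borel integrals over the
  plane: \<open>minus_embed\<close> is bounded and linear, and the integrand vanishes off the
  disk.\<close>

lemma set_integral_minus_embed:
  assumes u: "integrable lborel u" and zero: "\<And>z. z \<notin> unit_disk \<Longrightarrow> u z = 0"
    and eq: "\<And>z. X z = minus_embed (u z)"
  shows "(LINT z:unit_disk|lebesgue. X z) = minus_embed (\<integral>z. u z \<partial>lborel)"
proof -
  have [measurable]: "u \<in> borel_measurable borel" using u by simp
  have [measurable]: "minus_embed \<in> borel_measurable borel"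
    by (intro borel_measurable_continuous_onI linear_continuous_on bounded_linear_minus_embed)
  have "(LINT z:unit_disk|lebesgue. X z) = (\<integral>z. minus_embed (u z) \<partial>lebesgue)"
    unfolding set_lebesgue_integral_def
    by (intro Bochner_Integration.integral_cong refl)
      (auto simp: eq zero indicator_def minus_embed_zero)
  also have "\<dots> = (\<integral>z. minus_embed (u z) \<partial>lborel)"
    by (rule integral_completion) measurable
  also have "\<dots> = minus_embed (\<integral>z. u z \<partial>lborel)"
    by (rule integral_bounded_linear[OF bounded_linear_minus_embed u])
  finally show ?thesis .
qed

lemma loc_integrable_minus_embed:
  assumes "\<And>K. compact K \<Longrightarrow> integrable lborel (\<lambda>z. indicator K z *\<^sub>R u z)"
  shows "loc_integrable (\<lambda>z. minus_embed (u z))"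
  unfolding loc_integrable_def set_integrable_def
proof (intro allI impI, elim conjE)
  fix K :: "complex set" assume "compact K"
  then have "integrable lborel (\<lambda>z. minus_embed (indicator K z *\<^sub>R u z))"
    by (intro integrable_bounded_linear[OF bounded_linear_minus_embed] assms)
  then have "integrable lborel (\<lambda>z. indicator K z *\<^sub>R minus_embed (u z))"
    by (simp add: minus_embed_scaleR)
  then show "integrable lebesgue (\<lambda>z. indicator K z *\<^sub>R minus_embed (u z))"
    by (subst integrable_completion) auto
qed

lemma integrable_continuous_mult_on_compact:
  fixes u f :: "complex \<Rightarrow> complex"
  assumes u: "continuous_on UNIV u" and f: "integrable lborel f" and K: "compact K"
  shows "integrable lborel (\<lambda>z. indicator K z *\<^sub>R (u z * f z))"
proof -
  have [measurable]: "u \<in> borel_measurable borel" "f \<in> borel_measurable borel" "K \<in> sets borel"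
    using u f K by (simp_all add: borel_measurable_continuous_onI compact_imp_closed)
  have "bounded (u ` K)"
    using u K by (intro compact_imp_bounded compact_continuous_image continuous_on_subset[OF u]) auto
  then obtain B where B: "B > 0" "\<And>z. z \<in> K \<Longrightarrow> cmod (u z) \<le> B"
    unfolding bounded_pos by auto
  show ?thesis
  proof (rule Bochner_Integration.integrable_bound)
    show "integrable lborel (\<lambda>z. B * cmod (f z))" using f by simp
    show "AE z in lborel. norm (indicator K z *\<^sub>R (u z * f z)) \<le> norm (B * cmod (f z))"
      using B by (intro AE_I2) (auto simp: indicator_def norm_mult mult_right_mono)
  qed simp
qed

text \<open>A product rule for h e^s with h of class C^1: inserting \<phi>h as test function into
  the equation for e^s distributes dbar over \<phi> and h and yields the term h f e^s.\<close>

lemma weak_dbar_minus_embed: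
  fixes f s h h1 hi :: "complex \<Rightarrow> complex"
  assumes f: "integrable lborel f" and s: "continuous_on UNIV s"
    and s_eq: "\<And>\<psi> \<psi>1 \<psi>i R. \<lbrakk>continuous_on UNIV \<psi>; continuous_on UNIV \<psi>1; continuous_on UNIV \<psi>i;
       \<And>z. cmod z > R \<Longrightarrow> \<psi> z = 0 \<and> \<psi>1 z = 0 \<and> \<psi>i z = 0;
       \<And>z. dir_deriv 1 \<psi> (\<psi>1 z) z; \<And>z. dir_deriv \<i> \<psi> (\<psi>i z) z\<rbrakk> \<Longrightarrow>
       (\<integral>z. (\<psi>1 z + \<i> * \<psi>i z) / 2 * exp (s z) \<partial>lborel) = - (\<integral>z. \<psi> z * (f z * exp (s z)) \<partial>lborel)"
    and h: "continuous_on UNIV h" "continuous_on UNIV h1" "continuous_on UNIV hi"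
    and dh: "\<And>z. dir_deriv 1 h (h1 z) z" "\<And>z. dir_deriv \<i> h (hi z) z"
  shows "weak_dbar (\<lambda>z. minus_embed (h z * exp (s z)))
    (\<lambda>z. minus_embed ((h1 z + \<i> * hi z) / 2 * exp (s z) + h z * exp (s z) * f z))"
  unfolding weak_dbar_def
proof (intro conjI allI impI)
  note [continuous_intros] = s h
  let ?hb = "\<lambda>z. (h1 z + \<i> * hi z) / 2"
  have cont: "continuous_on UNIV (\<lambda>z. h z * exp (s z))" "continuous_on UNIV (\<lambda>z. ?hb z * exp (s z))"
    by (intro continuous_intros; simp)+
  have compact_int: "integrable lborel (\<lambda>z. indicator K z *\<^sub>R v z)" if "compact K" "continuous_on UNIV v" for K and v :: "complex \<Rightarrow> complex"
    using that by (intro borel_integrable_compact continuous_on_subset[OF that(2)]) auto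
  show "loc_integrable (\<lambda>z. minus_embed (h z * exp (s z)))"
    by (intro loc_integrable_minus_embed compact_int cont)
  show "loc_integrable (\<lambda>z. minus_embed (?hb z * exp (s z) + h z * exp (s z) * f z))"
    unfolding distrib_left scaleR_add_right
    by (intro loc_integrable_minus_embed, unfold scaleR_add_right,
        intro Bochner_Integration.integrable_add compact_int integrable_continuous_mult_on_compact cont f)
  fix \<phi> assume "test_function \<phi>"
  then obtain \<phi>: "continuous_on UNIV \<phi>" "continuous_on UNIV (pd_x \<phi>)" "continuous_on UNIV (pd_y \<phi>)"
    "\<And>z. dir_deriv 1 (\<lambda>z. of_real (\<phi> z)) (of_real (pd_x \<phi> z)) z"
    "\<And>z. dir_deriv \<i> (\<lambda>z. of_real (\<phi> z)) (of_real (pd_y \<phi> z)) z"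
    "\<And>z. z \<notin> unit_disk \<Longrightarrow> \<phi> z = 0 \<and> pd_x \<phi> z = 0 \<and> pd_y \<phi> z = 0"
    using test_function_properties by metis
  note [continuous_intros] = \<phi>(1-3)
  let ?p = "\<lambda>z. (of_real (pd_x \<phi> z) + \<i> * of_real (pd_y \<phi> z)) / 2 :: complex"
  let ?\<phi> = "\<lambda>z. of_real (\<phi> z) :: complex"
  have p0: "?p z = 0" "?\<phi> z = 0" if "z \<notin> unit_disk" for z using \<phi>(6)[OF that] by auto
  have supp: "z \<notin> unit_disk" if "cmod z > 1" for z using that by simp
  have I1: "integrable lborel (\<lambda>z. ?p z * (h z * exp (s z)))"
    and I2: "integrable lborel (\<lambda>z. ?\<phi> z * (?hb z * exp (s z)))"
    by (rule integrable_compact_support[of _ 1]; (intro continuous_intros; simp)?; simp add: p0[OF supp])+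
  have I3: "integrable lborel (\<lambda>z. ?\<phi> z * (h z * exp (s z) * f z))"
  proof -
    have "integrable lborel (\<lambda>z. indicator (cball 0 1) z *\<^sub>R ((?\<phi> z * (h z * exp (s z))) * f z))"
      by (intro integrable_continuous_mult_on_compact f continuous_intros) auto
    moreover have "indicator (cball 0 1) z *\<^sub>R ((?\<phi> z * (h z * exp (s z))) * f z) = ?\<phi> z * (h z * exp (s z) * f z)" for z
      using p0(2)[OF supp, of z] by (auto simp: indicator_def)
    ultimately show ?thesis by simp
  qed
  \<comment> \<open>The equation for e^s tested with \<phi>h, whose partials are expanded by the
    product rule.\<close>
  have main: "(\<integral>z. (?\<phi> z * h1 z + of_real (pd_x \<phi> z) * h z + \<i> * (?\<phi> z * hi z + of_real (pd_y \<phi> z) * h z)) / 2 * exp (s z) \<partial>lborel)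
     = - (\<integral>z. ?\<phi> z * h z * (f z * exp (s z)) \<partial>lborel)"
  proof (rule s_eq[of _ _ _ 1])
    show "dir_deriv 1 (\<lambda>z. ?\<phi> z * h z) (?\<phi> z * h1 z + of_real (pd_x \<phi> z) * h z) z"
      "dir_deriv \<i> (\<lambda>z. ?\<phi> z * h z) (?\<phi> z * hi z + of_real (pd_y \<phi> z) * h z) z" for z
      by (intro dir_deriv_mult \<phi> dh)+
    show "?\<phi> z * h z = 0 \<and> ?\<phi> z * h1 z + of_real (pd_x \<phi> z) * h z = 0
       \<and> ?\<phi> z * hi z + of_real (pd_y \<phi> z) * h z = 0" if "cmod z > 1" for z
      using \<phi>(6)[OF supp[OF that]] by simp
  qed (intro continuous_intros)+
  have "(\<integral>z. ?p z * (h z * exp (s z)) \<partial>lborel) + (\<integral>z. ?\<phi> z * (?hb z * exp (s z)) \<partial>lborel)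
    = (\<integral>z. ?p z * (h z * exp (s z)) + ?\<phi> z * (?hb z * exp (s z)) \<partial>lborel)"
    using I1 I2 by (rule Bochner_Integration.integral_add[symmetric])
  also have "\<dots> = (\<integral>z. (?\<phi> z * h1 z + of_real (pd_x \<phi> z) * h z + \<i> * (?\<phi> z * hi z + of_real (pd_y \<phi> z) * h z)) / 2 * exp (s z) \<partial>lborel)"
    by (intro Bochner_Integration.integral_cong refl) (simp add: field_simps)
  also have "\<dots> = - (\<integral>z. ?\<phi> z * (h z * exp (s z) * f z) \<partial>lborel)"
    unfolding main by (simp only: mult_ac)
  finally have "(\<integral>z. ?p z * (h z * exp (s z)) \<partial>lborel)
    = - ((\<integral>z. ?\<phi> z * (?hb z * exp (s z)) \<partial>lborel) + (\<integral>z. ?\<phi> z * (h z * exp (s z) * f z) \<partial>lborel))"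
    by (simp add: algebra_simps eq_neg_iff_add_eq_0)
  also have "\<dots> = - (\<integral>z. ?\<phi> z * (?hb z * exp (s z)) + ?\<phi> z * (h z * exp (s z) * f z) \<partial>lborel)"
    using I2 I3 by simp
  finally have id: "(\<integral>z. ?p z * (h z * exp (s z)) \<partial>lborel)
    = - (\<integral>z. ?\<phi> z * (?hb z * exp (s z)) + ?\<phi> z * (h z * exp (s z) * f z) \<partial>lborel)" .
  have "(LINT z:unit_disk|lebesgue. ((1/2) *\<^sub>R (of_real (pd_x \<phi> z) + bc_j * of_real (pd_y \<phi> z))) * minus_embed (h z * exp (s z)))
     = minus_embed (\<integral>z. ?p z * (h z * exp (s z)) \<partial>lborel)"
  proof (rule set_integral_minus_embed[OF I1])
    show "?p z * (h z * exp (s z)) = 0" if "z \<notin> unit_disk" for z using p0[OF that] by simp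
    show "((1/2) *\<^sub>R (of_real (pd_x \<phi> z) + bc_j * of_real (pd_y \<phi> z))) * minus_embed (h z * exp (s z))
      = minus_embed (?p z * (h z * exp (s z)))" for z
    proof -
      \<comment> \<open>Here j turns into \<i>: the bicomplex dbar of the test function acts on the
        ideal as the complex one.\<close>
      have "bc_minus ((1/2) *\<^sub>R (of_real (pd_x \<phi> z) + bc_j * of_real (pd_y \<phi> z))) = ?p z"
        by (simp add: bc_minus_def of_real_def[where 'a=bicomplex]) (simp add: scaleR_conv_of_real field_simps)
      then show ?thesis unfolding mult_minus_embed by (simp only: mult.assoc)
    qed
  qed
  moreover have "(LINT z:unit_disk|lebesgue. \<phi> z *\<^sub>R minus_embed (?hb z * exp (s z) + h z * exp (s z) * f z))
     = minus_embed (\<integral>z. ?\<phi> z * (?hb z * exp (s z)) + ?\<phi> z * (h z * exp (s z) * f z) \<partial>lborel)"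
  proof (rule set_integral_minus_embed)
    show "integrable lborel (\<lambda>z. ?\<phi> z * (?hb z * exp (s z)) + ?\<phi> z * (h z * exp (s z) * f z))"
      using I2 I3 by (rule Bochner_Integration.integrable_add)
    show "?\<phi> z * (?hb z * exp (s z)) + ?\<phi> z * (h z * exp (s z) * f z) = 0" if "z \<notin> unit_disk" for z
      using p0(2)[OF that] by simp
    show "\<phi> z *\<^sub>R minus_embed (?hb z * exp (s z) + h z * exp (s z) * f z)
      = minus_embed (?\<phi> z * (?hb z * exp (s z)) + ?\<phi> z * (h z * exp (s z) * f z))" for z
      by (simp only: minus_embed_scaleR[symmetric] scaleR_conv_of_real[where 'a=complex] distrib_left)
  qed
  ultimately show "(LINT z:unit_disk|lebesgue. ((1/2) *\<^sub>R (of_real (pd_x \<phi> z) + bc_j * of_real (pd_y \<phi> z))) * minus_embed (h z * exp (s z)))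
     = - (LINT z:unit_disk|lebesgue. \<phi> z *\<^sub>R minus_embed (?hb z * exp (s z) + h z * exp (s z) * f z))"
    by (simp only: id minus_embed_minus)
qed

section \<open>The one-parameter family of solutions\<close>

theorem corollary3p13:
  fixes n :: nat and q :: real and A :: "complex \<Rightarrow> bicomplex"
  assumes "n \<ge> 2" and "q > 2" and "A \<in> W_space (n - 1) q"
  shows "infinite ((\<lambda>w. restrict w (cball 0 1)) ` {w. dirichlet_solution n A w})"
proof -
  have "A \<in> L_space q" "q > 1" using assms by (auto simp: W_space_def)
  then obtain f where f: "integrable lborel f" "integrable lborel (\<lambda>z. cmod (f z) powr q)"
    and Af: "AE z in lebesgue_on unit_disk. bc_minus (A z) = f z"
    using L_space_borel_representative by metis
  obtain s where s: "continuous_on UNIV s"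
    and s_eq: "\<And>\<psi> \<psi>1 \<psi>i R. \<lbrakk>continuous_on UNIV \<psi>; continuous_on UNIV \<psi>1; continuous_on UNIV \<psi>i;
       \<And>z. cmod z > R \<Longrightarrow> \<psi> z = 0 \<and> \<psi>1 z = 0 \<and> \<psi>i z = 0;
       \<And>z. dir_deriv 1 \<psi> (\<psi>1 z) z; \<And>z. dir_deriv \<i> \<psi> (\<psi>i z) z\<rbrakk> \<Longrightarrow>
       (\<integral>z. (\<psi>1 z + \<i> * \<psi>i z) / 2 * exp (s z) \<partial>lborel) = - (\<integral>z. \<psi> z * (f z * exp (s z)) \<partial>lborel)"
    using exp_solves_dbar_equation[OF assms(2) f] by blast
  \<comment> \<open>The term h f e^s of the product rule cancels against A w, because A acts as
    \<open>f\<close> almost everywhere. On functions h e^s the operator thus reduces to dbar applied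
    to h.\<close>
  have vekua: "vekua_op A (\<lambda>z. minus_embed (h z * exp (s z))) (\<lambda>z. minus_embed ((h1 z + \<i> * hi z) / 2 * exp (s z)))"
    if "continuous_on UNIV h" "continuous_on UNIV h1" "continuous_on UNIV hi"
      "\<And>z. dir_deriv 1 h (h1 z) z" "\<And>z. dir_deriv \<i> h (hi z) z" for h h1 hi
    unfolding vekua_op_def
  proof (intro exI conjI)
    show "weak_dbar (\<lambda>z. minus_embed (h z * exp (s z)))
      (\<lambda>z. minus_embed ((h1 z + \<i> * hi z) / 2 * exp (s z) + h z * exp (s z) * f z))"
      using that by (intro weak_dbar_minus_embed[OF f(1) s s_eq]) auto
    show "AE z in lebesgue_on unit_disk. minus_embed ((h1 z + \<i> * hi z) / 2 * exp (s z))
      = minus_embed ((h1 z + \<i> * hi z) / 2 * exp (s z) + h z * exp (s z) * f z) - A z * minus_embed (h z * exp (s z))"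
      using Af
    proof eventually_elim
      case (elim z)
      show ?case
        unfolding mult_minus_embed elim minus_embed_diff[symmetric] by simp
    qed
  qed
  have zero: "vekua_op A (\<lambda>z. 0) (\<lambda>z. 0)"
    using vekua[of "\<lambda>_. 0" "\<lambda>_. 0" "\<lambda>_. 0"] by (simp add: dir_deriv_def minus_embed_zero)
  have zeros: "(vekua_op A ^^ m) (\<lambda>z. 0) (\<lambda>z. 0)" for m
    by (induction m) (auto intro: relpowp_Suc_I zero)
  define h where "h c z = of_real c * (1 - z * cnj z)" for c :: real and z
  define w where "w c z = minus_embed (h c z * exp (s z))" for c z
  have "dirichlet_solution n A (w c)" for c
  proof -
    let ?v = "\<lambda>z. - (of_real c * z) :: complex"
    have dh: "dir_deriv d (h c) (- of_real c * (d * cnj z + z * cnj d)) z" for d z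
      unfolding dir_deriv_def h_def by (auto intro!: derivative_eq_intros simp: algebra_simps)
    have dv: "dir_deriv d ?v (- of_real c * d) z" for d z
      unfolding dir_deriv_def by (auto intro!: derivative_eq_intros)
    \<comment> \<open>The combination is the derivative with respect to cnj z, and that of c(1 - z
      cnj z) is -cz.\<close>
    have hb: "(- of_real c * (1 * cnj z + z * cnj 1) + \<i> * (- of_real c * (\<i> * cnj z + z * cnj \<i>))) / 2 = ?v z" for z
      by (simp add: field_simps)
    \<comment> \<open>The function -cz is holomorphic, so dbar annihilates it.\<close>
    have hv: "(- of_real c * 1 + \<i> * (- of_real c * \<i>)) / 2 = (0 :: complex)"
      by (simp add: field_simps)
    have "vekua_op A (w c) (\<lambda>z. minus_embed ((- of_real c * (1 * cnj z + z * cnj 1)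
        + \<i> * (- of_real c * (\<i> * cnj z + z * cnj \<i>))) / 2 * exp (s z)))"
      unfolding w_def[abs_def]
      by (rule vekua[OF _ _ _ dh dh]) (auto intro!: continuous_intros simp: h_def[abs_def])
    then have 1: "vekua_op A (w c) (\<lambda>z. minus_embed (?v z * exp (s z)))"
      by (simp only: hb)
    have "vekua_op A (\<lambda>z. minus_embed (?v z * exp (s z)))
        (\<lambda>z. minus_embed ((- of_real c * 1 + \<i> * (- of_real c * \<i>)) / 2 * exp (s z)))"
      by (rule vekua[OF _ _ _ dv dv]) (auto intro!: continuous_intros)
    then have 2: "vekua_op A (\<lambda>z. minus_embed (?v z * exp (s z))) (\<lambda>z. 0)"
      by (simp only: hv mult_zero_left minus_embed_zero)
    \<comment> \<open>Two applications reach 0, for which n \<ge> 2 leaves room; the remaining m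
      applications stay at 0.\<close>
    obtain m where "n = Suc (Suc m)"
      using assms(1) by (metis add_2_eq_Suc le_Suc_ex)
    then have "(vekua_op A ^^ n) (w c) (\<lambda>z. 0)"
      using relpowp_Suc_I2[OF 1 relpowp_Suc_I2[OF 2 zeros]] by simp
    moreover have "continuous_on (cball 0 1) (w c)"
      unfolding w_def h_def
      by (intro bounded_linear.continuous_on[OF bounded_linear_minus_embed] continuous_intros continuous_on_subset[OF s]) auto
    moreover have "w c z = 0" if "z \<in> sphere 0 1" for z
    proof -
      have "z * cnj z = 1" using that by (simp add: complex_norm_square[symmetric])
      then show ?thesis by (simp add: w_def h_def minus_embed_zero)
    qed
    ultimately show ?thesis by (simp add: dirichlet_solution_def)
  qed
  \<comment> \<open>Solutions are counted by their restrictions to the closed disk, since their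
    values elsewhere are arbitrary.\<close>
  then have sub: "range (\<lambda>c. restrict (w c) (cball 0 1)) \<subseteq> (\<lambda>w. restrict w (cball 0 1)) ` {w. dirichlet_solution n A w}"
    by auto
  have "inj (\<lambda>c. restrict (w c) (cball 0 1))"
  proof (rule injI)
    fix c d assume "restrict (w c) (cball 0 1) = restrict (w d) (cball 0 1)"
    \<comment> \<open>At the centre \<open>h c 0\<close> is c and the exponential is nonzero, so the
      value there determines c.\<close>
    then have "restrict (w c) (cball 0 1) 0 = restrict (w d) (cball 0 1) 0" by (simp only:)
    then show "c = d" by (simp add: w_def h_def minus_embed_def)
  qed
  then have "infinite (range (\<lambda>c. restrict (w c) (cball 0 1)))"
    by (simp add: finite_image_iff infinite_UNIV_char_0)
  then show ?thesis using sub infinite_super by blast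
qed

end
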